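(* Let $a,b\in\mathbb C$ and $\omega=e^{2\pi i/3}$. In the $Y(\mathfrak{sl}(3))$-module $V(\lambda_1,a)\otimes V(\lambda_2,b)$, for all $i,j\in\{1,2,3\}$ with $(i,j)\neq(1,1)$ and all $k,m\in\{1,2,3\}$, $$J(T_i^{(j)})\psi_k^{(m)}=\Bigl[a\,\omega^{(j-1)(k-1)}-b\,\omega^{(i-1)(m-1)}+\tfrac32\,\delta_{i+k-1,1}\,\delta_{m+j-1,1}\,\omega^{(j-1)(k-1)}-\tfrac32\,\delta_{k,1}\,\delta_{m,1}\Bigr]\psi_{i+k-1}^{(m+j-1)},$$ where all indices of $\psi$, and the equalities tested by the Kronecker deltas, are taken modulo $3$.
   Context: $E_{ij}$ ($i,j\in\{1,2,3\}$, read modulo $3$) are the $3\times3$ matrix units. For $i,j\in\{1,2,3\}$, $(i,j)\ne(1,1)$, set $$T_i^{(j)}=\sum_{p=1}^{3}\omega^{(i-1)(p-1)}E_{p,p+j-1}\in\mathfrak{sl}(3),$$ equivalently $T_i^{(j)}=\omega^{3-i+1}A_{i-1,j-1}$ with $A_{kl}=\sum_p\omega^{kp}E_{p,p+l}$. For example $T_2^{(1)}=E_{11}+\omega E_{22}+\omega^2E_{33}$ and $T_1^{(2)}=E_{12}+E_{23}+E_{31}$. These form a basis of $\mathfrak{sl}(3)$. Yangian $Y(\mathfrak{sl}(3))$ (Drinfeld's first presentation): the associative unital algebra over $\mathbb C$ generated by elements $x,J(x)$ ($x\in\mathfrak{sl}(3)$), with $x\mapsto x$ and $x\mapsto J(x)$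 linear, the Lie bracket relations of $\mathfrak{sl}(3)$, $[x,J(y)]=J([x,y])$, and $$[J(x),J([y,z])]+[J(z),J([x,y])]+[J(y),J([z,x])]=\sum_{\alpha,\beta,\gamma}\bigl([x,I_\alpha]\,\big|\,[[y,I_\beta],[z,I_\gamma]]\bigr)\{I_\alpha,I_\beta,I_\gamma\},$$ where $\{I_\alpha\}$ is an orthonormal basis of $\mathfrak{sl}(3)$ for $(x|y)=\mathrm{tr}(xy)$ and $\{z_1,z_2,z_3\}=\frac1{24}\sum_{\pi\in S_3}z_{\pi(1)}z_{\pi(2)}z_{\pi(3)}$. The coproduct is $\Delta(x)=x\otimes1+1\otimes x$ and $$\Delta(J(x))=J(x)\otimes1+1\otimes J(x)+\tfrac12[x\otimes1,\Omega],\qquad \Omega=\sum_\alpha I_\alpha\otimes I_\alpha.$$ $V(\lambda_1)=\mathbb C^3$ is the vector representation of $\mathfrak{sl}(3)$ with standard basis $u_0,u_1,u_2$ (so $E_{p+1,q+1}u_c=\delta_{qc}u_p$ for $p,q,c\in\{0,1,2\}$), and $V(\lambda_2)=V(\lambda_1)^*$ is its dual representation with dual basis $u_0^*,u_1^*,u_2^*$ (so, by the contragredient action, $E_{p+1,q+1}u_c^*=-\delta_{pc}u_q^*$, restricted to $\mathfrak{sl}(3)$). For a constant $c\in\mathbb C$, $V(\lambda_i,c)$ is the $Y(\mathfrak{sl}(3))$-module on $V(\lambda_i)$ where $x\in\mathfrak{sl}(3)$ acts as usual and $J(x)$ acts as $c\,x$. The tensor product is a $Y(\mathfrak{sl}(3))$-module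 via $\Delta$. Write $|p,q\rangle=u_p\otimes u_q^*$, with $p,q$ read modulo $3$. The maximally entangled states are $$\psi_k^{(m)}=\frac1{\sqrt3}\bigl(|0,m-1\rangle+\omega^{k-1}|1,m\rangle+\omega^{2(k-1)}|2,m+1\rangle\bigr),\qquad k,m\in\{1,2,3\},$$ with $k,m$ read modulo $3$. *)

theory Defs
  imports "HOL-Analysis.Analysis"
begin

section \<open>Associative unital algebras over the complex numbers\<close>

class complex_vector = ab_group_add +
  fixes scaleC :: "complex \<Rightarrow> 'a \<Rightarrow> 'a" (infixr "*\<^sub>C" 75)
  assumes scaleC_add_right: "c *\<^sub>C (x + y) = c *\<^sub>C x + c *\<^sub>C y"
    and scaleC_add_left: "(c + d) *\<^sub>C x = c *\<^sub>C x + d *\<^sub>C x"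
    and scaleC_scaleC: "c *\<^sub>C d *\<^sub>C x = (c * d) *\<^sub>C x"
    and scaleC_one: "1 *\<^sub>C x = x"

text \<open>Not based on \<^class>\<open>ring_1\<close>, which would require \<open>0 \<noteq> 1\<close>.\<close>

class complex_algebra = complex_vector + ring + monoid_mult +
  assumes mult_scaleC_left: "(c *\<^sub>C x) * y = c *\<^sub>C (x * y)"
    and mult_scaleC_right: "x * (c *\<^sub>C y) = c *\<^sub>C (x * y)"

lemma scaleC_zero_right [simp]: "c *\<^sub>C (0 :: 'a :: complex_vector) = 0"
  using scaleC_add_right[of c "0 :: 'a" 0] by simp

lemma scaleC_zero_left [simp]: "0 *\<^sub>C (x :: 'a :: complex_vector) = 0"
  using scaleC_add_left[of 0 0 x] by simp

lemma scaleC_minus_right: "c *\<^sub>C (- x :: 'a :: complex_vector) = - (c *\<^sub>C x)"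
  using scaleC_add_right[of c x "- x"] by (simp add: eq_neg_iff_add_eq_0 add.commute)

lemma scaleC_minus_left: "(- c) *\<^sub>C (x :: 'a :: complex_vector) = - (c *\<^sub>C x)"
  using scaleC_add_left[of c "- c" x] by (simp add: eq_neg_iff_add_eq_0 add.commute)

lemma scaleC_diff_right: "c *\<^sub>C (x - y :: 'a :: complex_vector) = c *\<^sub>C x - c *\<^sub>C y"
  using scaleC_add_right[of c x "- y"] by (simp add: scaleC_minus_right)

lemma scaleC_diff_left: "(c - d) *\<^sub>C (x :: 'a :: complex_vector) = c *\<^sub>C x - d *\<^sub>C x"
  using scaleC_add_left[of c "- d" x] by (simp add: scaleC_minus_left)

lemma scaleC_sum_right: "c *\<^sub>C (\<Sum>i\<in>A. f i :: 'a :: complex_vector) = (\<Sum>i\<in>A. c *\<^sub>C f i)"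
  by (induction A rule: infinite_finite_induct) (auto simp: scaleC_add_right)

lemma scaleC_sum_left: "(\<Sum>i\<in>A. c i) *\<^sub>C (x :: 'a :: complex_vector) = (\<Sum>i\<in>A. c i *\<^sub>C x)"
  by (induction A rule: infinite_finite_induct) (auto simp: scaleC_add_left)

lemmas scaleC_simps = scaleC_add_right scaleC_diff_right scaleC_minus_right scaleC_minus_left
  scaleC_scaleC mult_scaleC_left mult_scaleC_right

definition commutator :: "'a :: ring \<Rightarrow> 'a \<Rightarrow> 'a" where
  "commutator x y = x * y - y * x"

definition clinear :: "('a :: complex_vector \<Rightarrow> 'b :: complex_vector) \<Rightarrow> bool" where
  "clinear f \<longleftrightarrow> (\<forall>x y. f (x + y) = f x + f y) \<and> (\<forall>c x. f (c *\<^sub>C x) = c *\<^sub>C f x)"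

definition alg_hom :: "('a :: complex_algebra \<Rightarrow> 'b :: complex_algebra) \<Rightarrow> bool" where
  "alg_hom f \<longleftrightarrow> clinear f \<and> (\<forall>x y. f (x * y) = f x * f y) \<and> f 1 = 1"

lemma clinear_zero: "clinear f \<Longrightarrow> f 0 = 0"
  unfolding clinear_def by (metis add_cancel_right_right)

lemma clinear_add: "clinear f \<Longrightarrow> f (x + y) = f x + f y"
  and clinear_scale: "clinear f \<Longrightarrow> f (c *\<^sub>C x) = c *\<^sub>C f x"
  by (auto simp: clinear_def)

lemma clinear_minus: "clinear f \<Longrightarrow> f (- x) = - f x"
  using clinear_scale[of f "-1" x] by (simp add: scaleC_minus_left scaleC_one)

lemma clinear_diff: "clinear f \<Longrightarrow> f (x - y) = f x - f y"
  using clinear_add[of f x "- y"] by (simp add: clinear_minus)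

lemma clinear_sum: "clinear f \<Longrightarrow> f (\<Sum>i\<in>A. g i) = (\<Sum>i\<in>A. f (g i))"
  by (induction A rule: infinite_finite_induct) (auto simp: clinear_add clinear_zero)

lemmas clinear_simps = clinear_zero clinear_add clinear_scale clinear_minus clinear_diff clinear_sum

lemma alg_hom_linear: "alg_hom f \<Longrightarrow> clinear f"
  and alg_hom_mult: "alg_hom f \<Longrightarrow> f (x * y) = f x * f y"
  and alg_hom_one: "alg_hom f \<Longrightarrow> f 1 = 1"
  by (auto simp: alg_hom_def)

lemma alg_hom_comm: "alg_hom f \<Longrightarrow> f (commutator x y) = commutator (f x) (f y)"
  by (simp add: commutator_def alg_hom_mult clinear_diff[OF alg_hom_linear])


section \<open>Free algebras\<close>

text \<open>The free associative unital complex algebra on \<open>'g\<close>: algebra terms over \<open>'g\<close> modulo the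
  congruence generated by the algebra axioms.\<close>

datatype 'g alg_term =
    TGen 'g | TZero | TOne
  | TAdd "'g alg_term" "'g alg_term" | TMult "'g alg_term" "'g alg_term"
  | TScale complex "'g alg_term"

inductive term_eq :: "'g alg_term \<Rightarrow> 'g alg_term \<Rightarrow> bool" where
  te_refl: "term_eq s s"
| te_sym: "term_eq s t \<Longrightarrow> term_eq t s"
| te_trans: "term_eq s t \<Longrightarrow> term_eq t u \<Longrightarrow> term_eq s u"
| te_add: "term_eq s s' \<Longrightarrow> term_eq t t' \<Longrightarrow> term_eq (TAdd s t) (TAdd s' t')"
| te_mult: "term_eq s s' \<Longrightarrow> term_eq t t' \<Longrightarrow> term_eq (TMult s t) (TMult s' t')"
| te_scale: "term_eq s s' \<Longrightarrow> term_eq (TScale c s) (TScale c s')"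
| te_add_assoc: "term_eq (TAdd (TAdd s t) u) (TAdd s (TAdd t u))"
| te_add_comm: "term_eq (TAdd s t) (TAdd t s)"
| te_zero: "term_eq (TAdd TZero s) s"
| te_neg: "term_eq (TAdd (TScale (-1) s) s) TZero"
| te_mult_assoc: "term_eq (TMult (TMult s t) u) (TMult s (TMult t u))"
| te_one_left: "term_eq (TMult TOne s) s"
| te_one_right: "term_eq (TMult s TOne) s"
| te_distrib_right: "term_eq (TMult (TAdd s t) u) (TAdd (TMult s u) (TMult t u))"
| te_distrib_left: "term_eq (TMult s (TAdd t u)) (TAdd (TMult s t) (TMult s u))"
| te_scale_add: "term_eq (TScale c (TAdd s t)) (TAdd (TScale c s) (TScale c t))"
| te_add_scale: "term_eq (TScale (c + d) s) (TAdd (TScale c s) (TScale d s))"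
| te_scale_scale: "term_eq (TScale c (TScale d s)) (TScale (c * d) s)"
| te_scale_one: "term_eq (TScale 1 s) s"
| te_scale_left: "term_eq (TMult (TScale c s) t) (TScale c (TMult s t))"
| te_scale_right: "term_eq (TMult s (TScale c t)) (TScale c (TMult s t))"

quotient_type 'g free_alg = "'g alg_term" / term_eq
  by (intro equivpI reflpI sympI transpI) (blast intro: term_eq.intros)+

lift_definition gen :: "'g \<Rightarrow> 'g free_alg" is TGen .

instantiation free_alg :: (type) complex_algebra
begin

lift_definition zero_free_alg :: "'a free_alg" is TZero .
lift_definition one_free_alg :: "'a free_alg" is TOne .
lift_definition plus_free_alg :: "'a free_alg \<Rightarrow> 'a free_alg \<Rightarrow> 'a free_alg" is TAdd
  by (rule te_add)
lift_definition times_free_alg :: "'a free_alg \<Rightarrow> 'a free_alg \<Rightarrow> 'a free_alg" is TMult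
  by (rule te_mult)
lift_definition scaleC_free_alg :: "complex \<Rightarrow> 'a free_alg \<Rightarrow> 'a free_alg" is TScale
  by (rule te_scale)
lift_definition uminus_free_alg :: "'a free_alg \<Rightarrow> 'a free_alg" is "TScale (-1)"
  by (rule te_scale)
definition minus_free_alg :: "'a free_alg \<Rightarrow> 'a free_alg \<Rightarrow> 'a free_alg" where
  "minus_free_alg x y = x + (- y)"

instance
  by standard (simp add: minus_free_alg_def | (transfer,
      rule te_add_assoc te_add_comm te_zero te_neg te_mult_assoc te_one_left te_one_right
        te_distrib_right te_distrib_left te_scale_add te_add_scale te_scale_scale te_scale_one
        te_scale_left te_scale_right))+

end

primrec term_eval :: "('g \<Rightarrow> 'a :: complex_algebra) \<Rightarrow> 'g alg_term \<Rightarrow> 'a" where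
  "term_eval f (TGen g) = f g"
| "term_eval f TZero = 0"
| "term_eval f TOne = 1"
| "term_eval f (TAdd s t) = term_eval f s + term_eval f t"
| "term_eval f (TMult s t) = term_eval f s * term_eval f t"
| "term_eval f (TScale c s) = c *\<^sub>C term_eval f s"

lemma term_eval_cong: "term_eq s t \<Longrightarrow> term_eval f s = term_eval f t"
  by (induction rule: term_eq.induct)
     (auto simp: algebra_simps scaleC_add_right scaleC_add_left scaleC_scaleC scaleC_one
        scaleC_minus_left mult_scaleC_left mult_scaleC_right)

lift_definition free_lift :: "('g \<Rightarrow> 'a :: complex_algebra) \<Rightarrow> 'g free_alg \<Rightarrow> 'a" is term_eval
  by (rule term_eval_cong)

lemma free_lift_gen [simp]: "free_lift f (gen g) = f g"
  by transfer simp

lemma alg_hom_free_lift: "alg_hom (free_lift f)"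
  unfolding alg_hom_def clinear_def by (intro conjI allI; transfer; simp)


section \<open>Quotients by two-sided ideals\<close>

inductive_set ideal_gen :: "'a :: complex_algebra set \<Rightarrow> 'a set" for S where
  ideal_base: "r \<in> S \<Longrightarrow> r \<in> ideal_gen S"
| ideal_zero: "0 \<in> ideal_gen S"
| ideal_add: "r \<in> ideal_gen S \<Longrightarrow> s \<in> ideal_gen S \<Longrightarrow> r + s \<in> ideal_gen S"
| ideal_scale: "r \<in> ideal_gen S \<Longrightarrow> c *\<^sub>C r \<in> ideal_gen S"
| ideal_left: "r \<in> ideal_gen S \<Longrightarrow> x * r \<in> ideal_gen S"
| ideal_right: "r \<in> ideal_gen S \<Longrightarrow> r * x \<in> ideal_gen S"

definition ideal_cong :: "'a :: complex_algebra set \<Rightarrow> 'a \<Rightarrow> 'a \<Rightarrow> bool" where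
  "ideal_cong S x y \<longleftrightarrow> x - y \<in> ideal_gen S"

lemma ideal_minus: "r \<in> ideal_gen S \<Longrightarrow> - r \<in> ideal_gen S"
  using ideal_scale[of r S "-1"] by (simp add: scaleC_minus_left scaleC_one)

lemma ideal_cong_refl: "ideal_cong S x x"
  by (simp add: ideal_cong_def ideal_zero)

lemma ideal_cong_equivp: "equivp (ideal_cong S)"
proof (intro equivpI reflpI sympI transpI)
  show "ideal_cong S x x" for x by (rule ideal_cong_refl)
  show "ideal_cong S y x" if "ideal_cong S x y" for x y
    using ideal_minus[of "x - y" S] that by (simp add: ideal_cong_def)
  show "ideal_cong S x z" if "ideal_cong S x y" "ideal_cong S y z" for x y z
    using ideal_add[of "x - y" S "y - z"] that by (simp add: ideal_cong_def)
qed

lemma ideal_cong_add: "ideal_cong S x x' \<Longrightarrow> ideal_cong S y y' \<Longrightarrow> ideal_cong S (x + y) (x' + y')"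
  using ideal_add[of "x - x'" S "y - y'"] by (simp add: ideal_cong_def algebra_simps)

lemma ideal_cong_scale: "ideal_cong S x x' \<Longrightarrow> ideal_cong S (c *\<^sub>C x) (c *\<^sub>C x')"
  using ideal_scale[of "x - x'" S c] by (simp add: ideal_cong_def scaleC_diff_right)

lemma ideal_cong_uminus: "ideal_cong S x x' \<Longrightarrow> ideal_cong S (- x) (- x')"
  using ideal_cong_scale[of S x x' "-1"] by (simp add: scaleC_minus_left scaleC_one)

lemma ideal_cong_mult:
  assumes "ideal_cong S x x'" "ideal_cong S y y'"
  shows "ideal_cong S (x * y) (x' * y')"
proof -
  have "(x - x') * y + x' * (y - y') \<in> ideal_gen S"
    using assms unfolding ideal_cong_def by (intro ideal_add ideal_left ideal_right)
  then show ?thesis by (simp add: ideal_cong_def algebra_simps)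
qed

lemma ideal_cong_hom:
  assumes "alg_hom f" and "\<And>r. r \<in> S \<Longrightarrow> f r = 0" and "ideal_cong S x y"
  shows "f x = f y"
proof -
  have "f r = 0" if "r \<in> ideal_gen S" for r
    using that by induction
      (use assms(1,2) in \<open>auto simp: alg_hom_def clinear_simps\<close>)
  then have "f (x - y) = 0" using assms(3) by (simp add: ideal_cong_def)
  then show ?thesis using assms(1) by (simp add: alg_hom_def clinear_simps)
qed


section \<open>Matrix algebras and \<open>sl(3)\<close>\<close>

text \<open>A copy of the type of complex square matrices, on which \<open>*\<close> is the matrix product (on
  \<^typ>\<open>complex^'n^'n\<close> it is the entrywise product).\<close>

typedef 'n cmatrix = "UNIV :: (complex^'n^'n) set"
  morphisms mat_of Cmat ..

setup_lifting type_definition_cmatrix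

instantiation cmatrix :: (finite) complex_algebra
begin

lift_definition zero_cmatrix :: "'a cmatrix" is 0 .
lift_definition one_cmatrix :: "'a cmatrix" is "mat 1" .
lift_definition plus_cmatrix :: "'a cmatrix \<Rightarrow> 'a cmatrix \<Rightarrow> 'a cmatrix" is "(+)" .
lift_definition minus_cmatrix :: "'a cmatrix \<Rightarrow> 'a cmatrix \<Rightarrow> 'a cmatrix" is "(-)" .
lift_definition uminus_cmatrix :: "'a cmatrix \<Rightarrow> 'a cmatrix" is uminus .
lift_definition times_cmatrix :: "'a cmatrix \<Rightarrow> 'a cmatrix \<Rightarrow> 'a cmatrix" is "(**)" .
lift_definition scaleC_cmatrix :: "complex \<Rightarrow> 'a cmatrix \<Rightarrow> 'a cmatrix"
  is "\<lambda>c A. \<chi> i j. c * A $ i $ j" .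

instance
proof
  fix A B C :: "'a cmatrix" and c d :: complex
  show "A * B * C = A * (B * C)" by transfer (simp add: matrix_mul_assoc)
  show "(A + B) * C = A * C + B * C" "A * (B + C) = A * B + A * C"
    by (transfer, simp add: vec_eq_iff matrix_matrix_mult_def algebra_simps sum.distrib)+
  show "c *\<^sub>C A * B = c *\<^sub>C (A * B)" "A * c *\<^sub>C B = c *\<^sub>C (A * B)"
    by (transfer, simp add: vec_eq_iff matrix_matrix_mult_def sum_distrib_left mult_ac)+
qed (transfer; simp add: vec_eq_iff algebra_simps)+

end

lift_definition entry :: "'n::finite cmatrix \<Rightarrow> 'n \<Rightarrow> 'n \<Rightarrow> complex" is "\<lambda>A i j. A $ i $ j" .
lift_definition tr :: "'n::finite cmatrix \<Rightarrow> complex" is trace .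
lift_definition mtranspose :: "'n::finite cmatrix \<Rightarrow> 'n cmatrix" is transpose .

lemma cmatrix_eqI: "(\<And>i j. entry A i j = entry B i j) \<Longrightarrow> A = B"
  by transfer (simp add: vec_eq_iff)

lemma entry_simps [simp]:
  "entry 0 i j = 0" "entry 1 i j = of_bool (i = j)"
  "entry (A + B) i j = entry A i j + entry B i j"
  "entry (A - B) i j = entry A i j - entry B i j"
  "entry (- A) i j = - entry A i j"
  "entry (c *\<^sub>C A) i j = c * entry A i j"
  "entry (mtranspose A) i j = entry A j i"
  by (transfer; simp add: mat_def transpose_def)+

lemma entry_mult: "entry (A * B) i j = (\<Sum>k\<in>UNIV. entry A i k * entry B k j)"
  by transfer (simp add: matrix_matrix_mult_def)

lemma entry_sum: "entry (\<Sum>i\<in>S. f i) p q = (\<Sum>i\<in>S. entry (f i) p q)"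
  by (induction S rule: infinite_finite_induct) auto

lemma tr_entry: "tr A = (\<Sum>i\<in>UNIV. entry A i i)"
  by transfer (simp add: trace_def)

lemma tr_simps [simp]:
  "tr 0 = 0" "tr (A + B) = tr A + tr B" "tr (A - B) = tr A - tr B" "tr (- A) = - tr A"
  "tr (c *\<^sub>C A) = c * tr A" "tr (mtranspose A) = tr A"
  by (simp_all add: tr_entry sum.distrib sum_subtractf sum_negf sum_distrib_left)

lemma tr_sum: "tr (\<Sum>i\<in>S. f i) = (\<Sum>i\<in>S. tr (f i))"
  by (induction S rule: infinite_finite_induct) auto

lemma tr_mult_comm: "tr (A * B) = tr (B * A)"
  unfolding tr_entry entry_mult by (subst sum.swap) (simp add: mult.commute)

lemma tr_commutator [simp]: "tr (commutator A B) = 0"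
  by (simp add: commutator_def tr_mult_comm)

lemma mtranspose_simps:
  "mtranspose 0 = 0" "mtranspose (A + B) = mtranspose A + mtranspose B"
  "mtranspose (A - B) = mtranspose A - mtranspose B" "mtranspose (- A) = - mtranspose A"
  "mtranspose (c *\<^sub>C A) = c *\<^sub>C mtranspose A"
  by (auto intro!: cmatrix_eqI)

lemma mtranspose_mult: "mtranspose (A * B) = mtranspose B * mtranspose A"
  by (rule cmatrix_eqI) (simp add: entry_mult mult.commute)

lemma mtranspose_sum: "mtranspose (\<Sum>i\<in>S. f i) = (\<Sum>i\<in>S. mtranspose (f i))"
  by (induction S rule: infinite_finite_induct) (auto simp: mtranspose_simps)

lemma mat_of_simps:
  "mat_of (A + B) = mat_of A + mat_of B" "mat_of (A * B) = mat_of A ** mat_of B" "mat_of 1 = mat 1"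
  by (transfer; simp)+

typedef sl3 = "{A :: 3 cmatrix. tr A = 0}"
  morphisms sl_mat Sl
  by (rule exI[of _ 0]) simp

setup_lifting type_definition_sl3

instantiation sl3 :: complex_vector
begin

lift_definition zero_sl3 :: sl3 is 0 by simp
lift_definition plus_sl3 :: "sl3 \<Rightarrow> sl3 \<Rightarrow> sl3" is "(+)" by simp
lift_definition minus_sl3 :: "sl3 \<Rightarrow> sl3 \<Rightarrow> sl3" is "(-)" by simp
lift_definition uminus_sl3 :: "sl3 \<Rightarrow> sl3" is uminus by simp
lift_definition scaleC_sl3 :: "complex \<Rightarrow> sl3 \<Rightarrow> sl3" is "(*\<^sub>C)" by simp

instance
  by standard (transfer; simp add: scaleC_add_right scaleC_add_left scaleC_scaleC scaleC_one)+

end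

lift_definition lie :: "sl3 \<Rightarrow> sl3 \<Rightarrow> sl3" is commutator by simp

lift_definition form :: "sl3 \<Rightarrow> sl3 \<Rightarrow> complex" is "\<lambda>x y. tr (x * y)" .

definition orthonormal_basis :: "(nat \<Rightarrow> sl3) \<Rightarrow> bool" where
  "orthonormal_basis I \<longleftrightarrow>
     (\<forall>\<alpha><8. \<forall>\<beta><8. form (I \<alpha>) (I \<beta>) = of_bool (\<alpha> = \<beta>)) \<and>
     (\<forall>x. \<exists>c. x = (\<Sum>\<alpha><8. c \<alpha> *\<^sub>C I \<alpha>))"

lemma sl_mat_simps:
  "sl_mat 0 = 0" "sl_mat (x + y) = sl_mat x + sl_mat y" "sl_mat (x - y) = sl_mat x - sl_mat y"
  "sl_mat (- x) = - sl_mat x" "sl_mat (c *\<^sub>C x) = c *\<^sub>C sl_mat x"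
  "sl_mat (lie x y) = commutator (sl_mat x) (sl_mat y)"
  by (transfer; simp)+

lemma sl_mat_sum: "sl_mat (\<Sum>i\<in>S. f i) = (\<Sum>i\<in>S. sl_mat (f i))"
  by (induction S rule: infinite_finite_induct) (auto simp: sl_mat_simps)

lemma tr_sl_mat [simp]: "tr (sl_mat x) = 0"
  by transfer

definition gell_mann :: "nat \<Rightarrow> complex^3^3" where
  "gell_mann \<alpha> = [
     vector [vector [0, 1, 0], vector [1, 0, 0], vector [0, 0, 0]],
     vector [vector [0, - \<i>, 0], vector [\<i>, 0, 0], vector [0, 0, 0]],
     vector [vector [1, 0, 0], vector [0, - 1, 0], vector [0, 0, 0]],
     vector [vector [0, 0, 1], vector [0, 0, 0], vector [1, 0, 0]],
     vector [vector [0, 0, - \<i>], vector [0, 0, 0], vector [\<i>, 0, 0]],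
     vector [vector [0, 0, 0], vector [0, 0, 1], vector [0, 1, 0]],
     vector [vector [0, 0, 0], vector [0, 0, - \<i>], vector [0, \<i>, 0]],
     vector [vector [1 / csqrt 3, 0, 0], vector [0, 1 / csqrt 3, 0], vector [0, 0, - 2 / csqrt 3]]] ! \<alpha>"

lemma less_8_cases:
  assumes "(\<alpha>::nat) < 8"
  obtains "\<alpha> = 0" | "\<alpha> = 1" | "\<alpha> = 2" | "\<alpha> = 3" | "\<alpha> = 4" | "\<alpha> = 5" | "\<alpha> = 6" | "\<alpha> = 7"
  using assms by linarith

lemma orthonormal_basis_exists: "\<exists>I. orthonormal_basis I"
proof -
  define s where "s = csqrt 3"
  define r where "r = csqrt 2"
  have s: "s * s = 3" and r: "r * r = 2"
    unfolding s_def r_def by (metis power2_csqrt power2_eq_square)+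
  have nz: "s \<noteq> 0" "r \<noteq> 0" using s r by auto
  define e where "e = (\<lambda>\<alpha>. (1 / r) *\<^sub>C Cmat (gell_mann \<alpha>))"
  have entry_e: "entry (e \<alpha>) i j = 1 / r * gell_mann \<alpha> $ i $ j" for \<alpha> i j
    unfolding e_def entry_simps by (simp add: entry.rep_eq Cmat_inverse)
  define I where "I = (\<lambda>\<alpha>. Sl (e \<alpha>))"
  have tr_e: "tr (e \<alpha>) = 0" if "\<alpha> < 8" for \<alpha>
    using that by (cases rule: less_8_cases)
      (simp_all add: tr_entry entry_e sum_3 gell_mann_def vector_3 field_simps)
  have I: "sl_mat (I \<alpha>) = e \<alpha>" if "\<alpha> < 8" for \<alpha>
    using tr_e[OF that] by (simp add: I_def Sl_inverse)
  have "form (I \<alpha>) (I \<beta>) = of_bool (\<alpha> = \<beta>)" if "\<alpha> < 8" "\<beta> < 8" for \<alpha> \<beta>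
    unfolding form.rep_eq I[OF that(1)] I[OF that(2)]
    using that nz by (cases rule: less_8_cases; cases rule: less_8_cases[OF that(2)])
      (simp_all add: tr_entry entry_mult entry_e sum_3 gell_mann_def vector_3 s_def[symmetric]
         r s divide_simps)
  moreover have "\<exists>c. x = (\<Sum>\<alpha><8. c \<alpha> *\<^sub>C I \<alpha>)" for x
  proof -
    define X where "X = entry (sl_mat x)"
    have t: "X 3 3 = - X 1 1 - X 2 2"
      using tr_sl_mat[of x] unfolding X_def tr_entry sum_3 by (simp add: algebra_simps eq_neg_iff_add_eq_0)
    define c where "c = (\<lambda>\<alpha>. r / 2 * ([X 1 2 + X 2 1, \<i> * (X 1 2 - X 2 1), X 1 1 - X 2 2,
      X 1 3 + X 3 1, \<i> * (X 1 3 - X 3 1), X 2 3 + X 3 2, \<i> * (X 2 3 - X 3 2),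
      s * (X 1 1 + X 2 2)] ! \<alpha>))"
    have "sl_mat x = (\<Sum>\<alpha><8. c \<alpha> *\<^sub>C e \<alpha>)"
    proof (rule cmatrix_eqI)
      fix i j :: 3
      show "entry (sl_mat x) i j = entry (\<Sum>\<alpha><8. c \<alpha> *\<^sub>C e \<alpha>) i j"
        using exhaust_3[of i] exhaust_3[of j] nz
        by (auto simp: t entry_sum entry_e c_def gell_mann_def vector_3 X_def[symmetric]
            s_def[symmetric] lessThan_nat_numeral lessThan_Suc eval_nat_numeral field_simps)
    qed
    also have "\<dots> = sl_mat (\<Sum>\<alpha><8. c \<alpha> *\<^sub>C I \<alpha>)"
      by (simp add: sl_mat_sum sl_mat_simps I)
    finally have "x = (\<Sum>\<alpha><8. c \<alpha> *\<^sub>C I \<alpha>)" by (simp add: sl_mat_inject)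
    then show ?thesis by blast
  qed
  ultimately show ?thesis unfolding orthonormal_basis_def by blast
qed

text \<open>An arbitrary but fixed orthonormal basis for the trace form.\<close>

definition onb :: "nat \<Rightarrow> sl3" where
  "onb = (SOME I. orthonormal_basis I)"

lemma onb: "orthonormal_basis onb"
  unfolding onb_def by (rule someI_ex[OF orthonormal_basis_exists])

lemma form_sym: "form x y = form y x"
  by transfer (rule tr_mult_comm)

lemma form_lie: "form (lie x y) z = form x (lie y z)"
proof transfer
  fix x y z :: "3 cmatrix"
  have "tr (y * (x * z)) = tr (x * (z * y))"
    using tr_mult_comm[of y "x * z"] by (simp add: mult.assoc)
  then show "tr (commutator x y * z) = tr (x * commutator y z)"
    by (simp add: commutator_def algebra_simps)
qed

lemma form_simps:
  "form (x + y) z = form x z + form y z" "form (c *\<^sub>C x) z = c * form x z"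
  by (transfer; simp add: algebra_simps mult_scaleC_left)+

lemma clinear_form: "form (\<Sum>i\<in>S. f i) z = (\<Sum>i\<in>S. form (f i) z)"
proof (induction S rule: infinite_finite_induct)
  case (insert x F)
  then show ?case by (simp add: form_simps)
qed (transfer; simp)+

lemma onb_expand: "(\<Sum>\<alpha><8. form x (onb \<alpha>) *\<^sub>C onb \<alpha>) = x"
proof -
  obtain c where c: "x = (\<Sum>\<alpha><8. c \<alpha> *\<^sub>C onb \<alpha>)"
    using onb unfolding orthonormal_basis_def by blast
  have "form x (onb \<beta>) = c \<beta>" if "\<beta> < 8" for \<beta>
  proof -
    have "form x (onb \<beta>) = (\<Sum>\<alpha><8. c \<alpha> * form (onb \<alpha>) (onb \<beta>))"
      unfolding c by (simp add: clinear_form form_simps)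
    also have "\<dots> = (\<Sum>\<alpha><8. c \<alpha> * of_bool (\<alpha> = \<beta>))"
      using onb that unfolding orthonormal_basis_def by (intro sum.cong) auto
    also have "\<dots> = c \<beta>" using that by simp
    finally show ?thesis .
  qed
  then show ?thesis by (subst (2) c) (simp add: c[symmetric])
qed


section \<open>The Yangian of \<open>sl(3)\<close>\<close>

definition sym3 :: "'a :: complex_algebra \<Rightarrow> 'a \<Rightarrow> 'a \<Rightarrow> 'a" where
  "sym3 a b c = (1/24) *\<^sub>C (a * b * c + a * c * b + b * a * c + b * c * a + c * a * b + c * b * a)"

text \<open>The relators of Drinfeld's first presentation, for families \<open>X\<close>, \<open>J\<close> of elements of any
  algebra: \<open>X\<close> and \<open>J\<close> satisfy the defining relations iff all relators vanish.\<close>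

definition yangian_relators :: "(sl3 \<Rightarrow> 'a :: complex_algebra) \<Rightarrow> (sl3 \<Rightarrow> 'a) \<Rightarrow> 'a set" where
  "yangian_relators X J =
     {X (x + y) - (X x + X y) |x y. True} \<union>
     {X (c *\<^sub>C x) - c *\<^sub>C X x |c x. True} \<union>
     {J (x + y) - (J x + J y) |x y. True} \<union>
     {J (c *\<^sub>C x) - c *\<^sub>C J x |c x. True} \<union>
     {commutator (X x) (X y) - X (lie x y) |x y. True} \<union>
     {commutator (X x) (J y) - J (lie x y) |x y. True} \<union>
     {commutator (J x) (J (lie y z)) + commutator (J z) (J (lie x y)) + commutator (J y) (J (lie z x))
      - (\<Sum>\<alpha><8. \<Sum>\<beta><8. \<Sum>\<gamma><8.
           form (lie x (onb \<alpha>)) (lie (lie y (onb \<beta>)) (lie z (onb \<gamma>))) *\<^sub>C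
           sym3 (X (onb \<alpha>)) (X (onb \<beta>)) (X (onb \<gamma>))) |x y z. True}"

datatype yangian_gen = GX sl3 | GJ sl3

abbreviation free_relators :: "yangian_gen free_alg set" where
  "free_relators \<equiv> yangian_relators (\<lambda>x. gen (GX x)) (\<lambda>x. gen (GJ x))"

quotient_type yangian = "yangian_gen free_alg" / "ideal_cong free_relators"
  by (rule ideal_cong_equivp)

instantiation yangian :: complex_algebra
begin

lift_definition zero_yangian :: yangian is 0 .
lift_definition one_yangian :: yangian is 1 .
lift_definition plus_yangian :: "yangian \<Rightarrow> yangian \<Rightarrow> yangian" is "(+)"
  by (rule ideal_cong_add)
lift_definition times_yangian :: "yangian \<Rightarrow> yangian \<Rightarrow> yangian" is "(*)"
  by (rule ideal_cong_mult)
lift_definition scaleC_yangian :: "complex \<Rightarrow> yangian \<Rightarrow> yangian" is "(*\<^sub>C)"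
  by (rule ideal_cong_scale)
lift_definition uminus_yangian :: "yangian \<Rightarrow> yangian" is uminus
  by (rule ideal_cong_uminus)
definition minus_yangian :: "yangian \<Rightarrow> yangian \<Rightarrow> yangian" where
  "minus_yangian x y = x + (- y)"

instance
  by standard (simp add: minus_yangian_def | (transfer; simp add: ideal_cong_refl algebra_simps
      scaleC_add_right scaleC_add_left scaleC_scaleC scaleC_one mult_scaleC_left mult_scaleC_right))+

end

lift_definition yX :: "sl3 \<Rightarrow> yangian" is "\<lambda>x. gen (GX x)" .
lift_definition yJ :: "sl3 \<Rightarrow> yangian" is "\<lambda>x. gen (GJ x)" .

definition yangian_gen_val :: "(sl3 \<Rightarrow> 'a) \<Rightarrow> (sl3 \<Rightarrow> 'a) \<Rightarrow> yangian_gen \<Rightarrow> 'a" where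
  "yangian_gen_val X J g = (case g of GX x \<Rightarrow> X x | GJ x \<Rightarrow> J x)"

lemma alg_hom_abs_yangian: "alg_hom abs_yangian"
  unfolding alg_hom_def clinear_def
  by (simp add: plus_yangian.abs_eq times_yangian.abs_eq scaleC_yangian.abs_eq one_yangian_def)

lemma alg_hom_simps:
  assumes "alg_hom f"
  shows "f 0 = 0" "f (x + y) = f x + f y" "f (x - y) = f x - f y" "f (c *\<^sub>C x) = c *\<^sub>C f x"
    "f (x * y) = f x * f y" "f 1 = 1" "f (commutator x y) = commutator (f x) (f y)"
    "f (\<Sum>i\<in>S. g i) = (\<Sum>i\<in>S. f (g i))" "f (sym3 x y z) = sym3 (f x) (f y) (f z)"
  using assms by (simp_all add: clinear_simps alg_hom_linear alg_hom_comm alg_hom_mult alg_hom_one sym3_def)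

lemma setcompr_range:
  "{f x y |x y. True} = range (\<lambda>(x, y). f x y)"
  "{g x y z |x y z. True} = range (\<lambda>(x, y, z). g x y z)"
  by (simp_all add: image_def split_paired_Ex)

lemma yangian_relators_hom:
  assumes "alg_hom f"
  shows "f ` yangian_relators X J = yangian_relators (\<lambda>x. f (X x)) (\<lambda>x. f (J x))"
  unfolding yangian_relators_def image_Un setcompr_range image_image
  by (simp add: case_prod_unfold alg_hom_simps[OF assms])

lemma yangian_relators_vanish_iff:
  "yangian_relators X J \<subseteq> {0} \<longleftrightarrow> clinear X \<and> clinear J \<and>
     (\<forall>x y. commutator (X x) (X y) = X (lie x y)) \<and> (\<forall>x y. commutator (X x) (J y) = J (lie x y)) \<and>
     (\<forall>x y z. commutator (J x) (J (lie y z)) + commutator (J z) (J (lie x y)) + commutator (J y) (J (lie z x))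
      = (\<Sum>\<alpha><8. \<Sum>\<beta><8. \<Sum>\<gamma><8.
           form (lie x (onb \<alpha>)) (lie (lie y (onb \<beta>)) (lie z (onb \<gamma>))) *\<^sub>C
           sym3 (X (onb \<alpha>)) (X (onb \<beta>)) (X (onb \<gamma>))))"
  unfolding yangian_relators_def setcompr_range clinear_def Un_subset_iff image_subset_iff
    case_prod_unfold split_paired_all
  by (simp only: UNIV_I singleton_iff right_minus_eq split_paired_All fst_conv snd_conv simp_thms
      ball_UNIV conj_assoc)

lemma yangian_relations: "yangian_relators yX yJ \<subseteq> {0}"
proof -
  have "abs_yangian r = 0" if "r \<in> free_relators" for r
    using that unfolding zero_yangian_def
    by (simp add: yangian.abs_eq_iff ideal_cong_def ideal_base)
  then have "abs_yangian ` free_relators \<subseteq> {0}" by auto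
  then show ?thesis
    unfolding yangian_relators_hom[OF alg_hom_abs_yangian] by (simp add: yX_def yJ_def map_fun_def comp_def)
qed

lemma free_lift_respects:
  assumes "yangian_relators X J \<subseteq> {0}" and "ideal_cong free_relators s t"
  shows "free_lift (yangian_gen_val X J) s = free_lift (yangian_gen_val X J) t"
proof (rule ideal_cong_hom[OF alg_hom_free_lift _ assms(2)])
  fix r assume "r \<in> free_relators"
  then have "free_lift (yangian_gen_val X J) r \<in> free_lift (yangian_gen_val X J) ` free_relators"
    by (rule imageI)
  also have "\<dots> = yangian_relators X J"
    by (simp add: yangian_relators_hom[OF alg_hom_free_lift] yangian_gen_val_def)
  finally show "free_lift (yangian_gen_val X J) r = 0" using assms(1) by auto
qed

lemma clinear_yX: "clinear yX" and clinear_yJ: "clinear yJ"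
  and yX_comm: "commutator (yX x) (yX y) = yX (lie x y)"
  and yXJ_comm: "commutator (yX x) (yJ y) = yJ (lie x y)"
  and yJ_comm: "commutator (yJ x) (yJ (lie y z)) + commutator (yJ z) (yJ (lie x y)) + commutator (yJ y) (yJ (lie z x))
      = (\<Sum>\<alpha><8. \<Sum>\<beta><8. \<Sum>\<gamma><8.
           form (lie x (onb \<alpha>)) (lie (lie y (onb \<beta>)) (lie z (onb \<gamma>))) *\<^sub>C
           sym3 (yX (onb \<alpha>)) (yX (onb \<beta>)) (yX (onb \<gamma>)))"
  using yangian_relations unfolding yangian_relators_vanish_iff by blast+


section \<open>Tensor products of algebras\<close>

text \<open>Presented by the pure tensors, subject to bilinearity and
  \<open>(a \<otimes> b) (a' \<otimes> b') = a a' \<otimes> b b'\<close>.\<close>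

definition tensor_relators :: "('a :: complex_algebra \<times> 'b :: complex_algebra) free_alg set" where
  "tensor_relators =
     {gen (a + a', b) - (gen (a, b) + gen (a', b)) |a a' b. True} \<union>
     {gen (a, b + b') - (gen (a, b) + gen (a, b')) |a b b'. True} \<union>
     {gen (c *\<^sub>C a, b) - c *\<^sub>C gen (a, b) |c a b. True} \<union>
     {gen (a, c *\<^sub>C b) - c *\<^sub>C gen (a, b) |c a b. True} \<union>
     {gen (a, b) * gen (a', b') - gen (a * a', b * b') |a b a' b'. True} \<union>
     {gen (1, 1) - 1}"

quotient_type (overloaded) ('a, 'b) tensor = "('a :: complex_algebra \<times> 'b :: complex_algebra) free_alg" /
    "ideal_cong tensor_relators"
  by (rule ideal_cong_equivp)

instantiation tensor :: (complex_algebra, complex_algebra) complex_algebra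
begin

lift_definition zero_tensor :: "('a, 'b) tensor" is 0 .
lift_definition one_tensor :: "('a, 'b) tensor" is 1 .
lift_definition plus_tensor :: "('a, 'b) tensor \<Rightarrow> ('a, 'b) tensor \<Rightarrow> ('a, 'b) tensor" is "(+)"
  by (rule ideal_cong_add)
lift_definition times_tensor :: "('a, 'b) tensor \<Rightarrow> ('a, 'b) tensor \<Rightarrow> ('a, 'b) tensor" is "(*)"
  by (rule ideal_cong_mult)
lift_definition scaleC_tensor :: "complex \<Rightarrow> ('a, 'b) tensor \<Rightarrow> ('a, 'b) tensor" is "(*\<^sub>C)"
  by (rule ideal_cong_scale)
lift_definition uminus_tensor :: "('a, 'b) tensor \<Rightarrow> ('a, 'b) tensor" is uminus
  by (rule ideal_cong_uminus)
definition minus_tensor :: "('a, 'b) tensor \<Rightarrow> ('a, 'b) tensor \<Rightarrow> ('a, 'b) tensor" where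
  "minus_tensor x y = x + (- y)"

instance
  by standard (simp add: minus_tensor_def | (transfer; simp add: ideal_cong_refl algebra_simps
      scaleC_add_right scaleC_add_left scaleC_scaleC scaleC_one mult_scaleC_left mult_scaleC_right))+

end

lift_definition tens :: "'a :: complex_algebra \<Rightarrow> 'b :: complex_algebra \<Rightarrow> ('a, 'b) tensor"
  (infixr "\<otimes>" 75) is "\<lambda>a b. gen (a, b)" .

lemma ideal_cong_base: "x - y \<in> S \<Longrightarrow> ideal_cong S x y"
  by (simp add: ideal_cong_def ideal_base)

lemma tens_add_left: "(a + a') \<otimes> b = a \<otimes> b + a' \<otimes> b"
  and tens_add_right: "a \<otimes> (b + b') = a \<otimes> b + a \<otimes> b'"
  and tens_scale_left: "(c *\<^sub>C a) \<otimes> b = c *\<^sub>C (a \<otimes> b)"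
  and tens_scale_right: "a \<otimes> (c *\<^sub>C b) = c *\<^sub>C (a \<otimes> b)"
  and tens_mult: "(a \<otimes> b) * (a' \<otimes> b') = (a * a') \<otimes> (b * b')"
  and tens_one: "1 \<otimes> 1 = 1"
  by (transfer, rule ideal_cong_base, unfold tensor_relators_def, blast)+

lemma clinear_tens_left: "clinear (\<lambda>a. a \<otimes> b)" and clinear_tens_right: "clinear (\<lambda>b. a \<otimes> b)"
  by (auto simp: clinear_def tens_add_left tens_add_right tens_scale_left tens_scale_right)

lemmas tens_simps = tens_mult clinear_simps[OF clinear_tens_left] clinear_simps[OF clinear_tens_right]


section \<open>The coproduct\<close>

subsection \<open>Sums over the orthonormal basis\<close>

definition bilin :: "(sl3 \<Rightarrow> sl3 \<Rightarrow> 'a :: complex_vector) \<Rightarrow> bool" where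
  "bilin F \<longleftrightarrow> (\<forall>q. clinear (\<lambda>p. F p q)) \<and> (\<forall>p. clinear (\<lambda>q. F p q))"

lemma bilinI:
  assumes "\<And>p p' q. F (p + p') q = F p q + F p' q" "\<And>c p q. F (c *\<^sub>C p) q = c *\<^sub>C F p q"
    "\<And>p q q'. F p (q + q') = F p q + F p q'" "\<And>c p q. F p (c *\<^sub>C q) = c *\<^sub>C F p q"
  shows "bilin F"
  using assms by (auto simp: bilin_def clinear_def)

lemma lie_simps:
  "lie (x + y) z = lie x z + lie y z" "lie x (y + z) = lie x y + lie x z"
  "lie (c *\<^sub>C x) y = c *\<^sub>C lie x y" "lie x (c *\<^sub>C y) = c *\<^sub>C lie x y"
  by (transfer; simp add: commutator_def algebra_simps scaleC_simps)+

lemma lie_anti: "lie y x = - lie x y"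
  by transfer (simp add: commutator_def)

lemma jacobi: "lie x (lie y z) + lie z (lie x y) + lie y (lie z x) = 0"
  by transfer (simp add: commutator_def algebra_simps)

lemma jacobi': "lie (lie x y) z = lie x (lie y z) - lie y (lie x z)"
  by transfer (simp add: commutator_def algebra_simps)

lemma onb_contract:
  assumes "clinear F"
  shows "(\<Sum>\<alpha><8. form x (onb \<alpha>) *\<^sub>C F (onb \<alpha>)) = F x"
  using arg_cong[OF onb_expand[of x], of F] by (simp add: clinear_simps[OF assms])

lemma onb_invariant:
  assumes "bilin F"
  shows "(\<Sum>\<alpha><8. F (lie x (onb \<alpha>)) (onb \<alpha>)) = - (\<Sum>\<alpha><8. F (onb \<alpha>) (lie x (onb \<alpha>)))"
proof -
  have 1: "clinear (\<lambda>p. F p q)" and 2: "clinear (\<lambda>q. F p q)" for p q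
    using assms by (auto simp: bilin_def)
  have "(\<Sum>\<alpha><8. F (lie x (onb \<alpha>)) (onb \<alpha>))
      = (\<Sum>\<alpha><8. \<Sum>\<beta><8. form (lie x (onb \<alpha>)) (onb \<beta>) *\<^sub>C F (onb \<beta>) (onb \<alpha>))"
    by (simp add: onb_contract[OF 1])
  also have "\<dots> = (\<Sum>\<beta><8. \<Sum>\<alpha><8. form (lie x (onb \<alpha>)) (onb \<beta>) *\<^sub>C F (onb \<beta>) (onb \<alpha>))"
    by (rule sum.swap)
  also have "\<dots> = (\<Sum>\<beta><8. \<Sum>\<alpha><8. - (form (lie x (onb \<beta>)) (onb \<alpha>) *\<^sub>C F (onb \<beta>) (onb \<alpha>)))"
  proof -
    have fl: "form (lie x p) q = - form (lie x q) p" for p q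
    proof -
      have "form (lie x p) q = form (- lie p x) q" by (simp add: lie_anti[of x p])
      also have "\<dots> = - form (lie p x) q" using form_simps(2)[of "-1" "lie p x" q]
        by (simp add: scaleC_minus_left scaleC_one)
      finally show ?thesis by (metis form_lie form_sym)
    qed
    have flip: "form (lie x (onb \<alpha>)) (onb \<beta>) *\<^sub>C v = - (form (lie x (onb \<beta>)) (onb \<alpha>) *\<^sub>C v)" for \<alpha> \<beta> v
      unfolding fl[of "onb \<alpha>" "onb \<beta>"] by (rule scaleC_minus_left)
    show ?thesis by (intro sum.cong refl flip)
  qed
  also have "\<dots> = - (\<Sum>\<beta><8. F (onb \<beta>) (lie x (onb \<beta>)))"
    by (simp add: sum_negf onb_contract[OF 2])
  finally show ?thesis .
qed

lemma double_eq_zero: "s + s = 0 \<Longrightarrow> s = (0 :: 'a :: complex_vector)"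
  using scaleC_add_left[of 1 1 s] scaleC_scaleC[of "1/2" 2 s] by (simp add: scaleC_one)

text \<open>The structural identity behind the compatibility of the coproduct with the last relation.\<close>

lemma onb_terrific:
  fixes G :: "sl3 \<Rightarrow> sl3 \<Rightarrow> sl3 \<Rightarrow> 'a :: complex_vector"
  assumes lin: "\<And>p q. clinear (\<lambda>u. G u p q)" and sym: "\<And>u p q. G u p q = G u q p"
  shows "(\<Sum>\<alpha><8. \<Sum>\<beta><8. \<Sum>\<gamma><8. form (lie x (onb \<alpha>)) (lie (lie y (onb \<beta>)) (lie z (onb \<gamma>))) *\<^sub>C
            (G (onb \<alpha>) (onb \<beta>) (onb \<gamma>) + G (onb \<beta>) (onb \<alpha>) (onb \<gamma>) + G (onb \<gamma>) (onb \<alpha>) (onb \<beta>)))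
       = (\<Sum>\<alpha><8. \<Sum>\<beta><8. G (lie (lie x (onb \<alpha>)) (lie (lie y z) (onb \<beta>))) (onb \<alpha>) (onb \<beta>)
            + G (lie (lie z (onb \<alpha>)) (lie (lie x y) (onb \<beta>))) (onb \<alpha>) (onb \<beta>)
            + G (lie (lie y (onb \<alpha>)) (lie (lie z x) (onb \<beta>))) (onb \<alpha>) (onb \<beta>))"
    (is "?L = ?R")
proof -
  define N where "N = (\<lambda>y z x p q. lie (lie (lie y p) (lie z q)) x)"
  define C where "C = (\<lambda>\<alpha> \<beta> \<gamma>. form (lie x (onb \<alpha>)) (lie (lie y (onb \<beta>)) (lie z (onb \<gamma>))))"
  have cyc: "form a (lie b c) = form b (lie c a)" for a b c
    by (metis form_lie form_sym)
  have C1: "C \<alpha> \<beta> \<gamma> = form (N y z x (onb \<beta>) (onb \<gamma>)) (onb \<alpha>)" for \<alpha> \<beta> \<gamma>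
    unfolding C_def N_def by (metis cyc form_lie form_sym)
  have C2: "C \<alpha> \<beta> \<gamma> = form (N z x y (onb \<gamma>) (onb \<alpha>)) (onb \<beta>)" for \<alpha> \<beta> \<gamma>
    unfolding C_def N_def by (metis cyc form_lie form_sym)
  have C3: "C \<alpha> \<beta> \<gamma> = form (N x y z (onb \<alpha>) (onb \<beta>)) (onb \<gamma>)" for \<alpha> \<beta> \<gamma>
    unfolding C_def N_def by (metis cyc form_lie form_sym)
  have T1: "(\<Sum>\<alpha><8. \<Sum>\<beta><8. \<Sum>\<gamma><8. C \<alpha> \<beta> \<gamma> *\<^sub>C G (onb \<alpha>) (onb \<beta>) (onb \<gamma>))
      = (\<Sum>\<alpha><8. \<Sum>\<beta><8. G (N y z x (onb \<alpha>) (onb \<beta>)) (onb \<alpha>) (onb \<beta>))"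
  proof -
    have "(\<Sum>\<alpha><8. \<Sum>\<beta><8. \<Sum>\<gamma><8. C \<alpha> \<beta> \<gamma> *\<^sub>C G (onb \<alpha>) (onb \<beta>) (onb \<gamma>))
       = (\<Sum>\<beta><8. \<Sum>\<alpha><8. \<Sum>\<gamma><8. C \<alpha> \<beta> \<gamma> *\<^sub>C G (onb \<alpha>) (onb \<beta>) (onb \<gamma>))"
      by (rule sum.swap)
    also have "\<dots> = (\<Sum>\<beta><8. \<Sum>\<gamma><8. \<Sum>\<alpha><8. C \<alpha> \<beta> \<gamma> *\<^sub>C G (onb \<alpha>) (onb \<beta>) (onb \<gamma>))"
      by (intro sum.cong refl sum.swap)
    also have "\<dots> = (\<Sum>\<beta><8. \<Sum>\<gamma><8. G (N y z x (onb \<beta>) (onb \<gamma>)) (onb \<beta>) (onb \<gamma>))"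
      unfolding C1 by (simp only: onb_contract[OF lin])
    finally show ?thesis .
  qed
  have T2: "(\<Sum>\<alpha><8. \<Sum>\<beta><8. \<Sum>\<gamma><8. C \<alpha> \<beta> \<gamma> *\<^sub>C G (onb \<beta>) (onb \<alpha>) (onb \<gamma>))
      = (\<Sum>\<alpha><8. \<Sum>\<beta><8. G (N z x y (onb \<alpha>) (onb \<beta>)) (onb \<alpha>) (onb \<beta>))"
  proof -
    have "(\<Sum>\<alpha><8. \<Sum>\<beta><8. \<Sum>\<gamma><8. C \<alpha> \<beta> \<gamma> *\<^sub>C G (onb \<beta>) (onb \<alpha>) (onb \<gamma>))
       = (\<Sum>\<alpha><8. \<Sum>\<gamma><8. \<Sum>\<beta><8. C \<alpha> \<beta> \<gamma> *\<^sub>C G (onb \<beta>) (onb \<alpha>) (onb \<gamma>))"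
      by (intro sum.cong refl sum.swap)
    also have "\<dots> = (\<Sum>\<alpha><8. \<Sum>\<gamma><8. G (N z x y (onb \<gamma>) (onb \<alpha>)) (onb \<gamma>) (onb \<alpha>))"
      unfolding C2 by (simp only: onb_contract[OF lin]) (simp add: sym)
    also have "\<dots> = (\<Sum>\<gamma><8. \<Sum>\<alpha><8. G (N z x y (onb \<gamma>) (onb \<alpha>)) (onb \<gamma>) (onb \<alpha>))"
      by (rule sum.swap)
    finally show ?thesis .
  qed
  have T3: "(\<Sum>\<alpha><8. \<Sum>\<beta><8. \<Sum>\<gamma><8. C \<alpha> \<beta> \<gamma> *\<^sub>C G (onb \<gamma>) (onb \<alpha>) (onb \<beta>))
      = (\<Sum>\<alpha><8. \<Sum>\<beta><8. G (N x y z (onb \<alpha>) (onb \<beta>)) (onb \<alpha>) (onb \<beta>))"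
    unfolding C3 by (simp only: onb_contract[OF lin])
  define D where "D = (\<lambda>p q. N y z x p q + N z x y p q + N x y z p q
     - (lie (lie x p) (lie (lie y z) q) + lie (lie z p) (lie (lie x y) q) + lie (lie y p) (lie (lie z x) q)))"
  have D: "D p q + D q p = 0" for p q
    unfolding D_def N_def by transfer (simp add: commutator_def algebra_simps)
  define s where "s = (\<Sum>\<alpha><8. \<Sum>\<beta><8. G (D (onb \<alpha>) (onb \<beta>)) (onb \<alpha>) (onb \<beta>))"
  have "s = (\<Sum>\<alpha><8. \<Sum>\<beta><8. G (D (onb \<beta>) (onb \<alpha>)) (onb \<alpha>) (onb \<beta>))"
    unfolding s_def by (subst sum.swap) (simp add: sym)
  then have "s + s = (\<Sum>\<alpha><8. \<Sum>\<beta><8. G (D (onb \<alpha>) (onb \<beta>) + D (onb \<beta>) (onb \<alpha>)) (onb \<alpha>) (onb \<beta>))"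
    unfolding clinear_add[OF lin] sum.distrib by (simp add: s_def)
  also have "\<dots> = 0" by (simp add: D clinear_zero[OF lin])
  finally have s0: "s = 0" by (rule double_eq_zero)
  have C: "form (lie x (onb \<alpha>)) (lie (lie y (onb \<beta>)) (lie z (onb \<gamma>))) = C \<alpha> \<beta> \<gamma>" for \<alpha> \<beta> \<gamma>
    by (simp add: C_def)
  have "?L - ?R = s"
    unfolding C scaleC_add_right sum.distrib T1 T2 T3 s_def D_def
      clinear_add[OF lin] clinear_diff[OF lin] sum_subtractf
    by simp
  then show ?thesis unfolding s0 right_minus_eq .
qed


subsection \<open>Compatibility with the defining relations\<close>

definition Omega :: "(yangian, yangian) tensor" where
  "Omega = (\<Sum>\<alpha><8. yX (onb \<alpha>) \<otimes> yX (onb \<alpha>))"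

definition coproduct_X :: "sl3 \<Rightarrow> (yangian, yangian) tensor" where
  "coproduct_X x = yX x \<otimes> 1 + 1 \<otimes> yX x"

definition coproduct_J :: "sl3 \<Rightarrow> (yangian, yangian) tensor" where
  "coproduct_J x = yJ x \<otimes> 1 + 1 \<otimes> yJ x + (1/2) *\<^sub>C commutator (yX x \<otimes> 1) Omega"

lemma commutator_simps:
  "commutator (a + b) c = commutator a c + commutator b c"
  "commutator a (b + c) = commutator a b + commutator a c"
  "commutator (t *\<^sub>C x) y = t *\<^sub>C commutator x y"
  "commutator x (t *\<^sub>C y) = t *\<^sub>C commutator x y"
  for a b c :: "'b :: ring" and x y :: "'a :: complex_algebra"
  by (auto simp: commutator_def algebra_simps scaleC_simps)

lemma commutator_sum_left: "commutator (\<Sum>i\<in>S. f i) y = (\<Sum>i\<in>S. commutator (f i) y)"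
  and commutator_sum_right: "commutator y (\<Sum>i\<in>S. f i) = (\<Sum>i\<in>S. commutator y (f i))"
  by (auto simp: commutator_def sum_distrib_left sum_distrib_right sum_subtractf)

lemma commutator_anti: "commutator y x = - commutator x y"
  by (simp add: commutator_def)

lemma commutator_tens:
  "commutator (a \<otimes> 1) (b \<otimes> c) = commutator a b \<otimes> c" "commutator (1 \<otimes> a) (b \<otimes> c) = b \<otimes> commutator a c"
  "commutator (b \<otimes> c) (a \<otimes> 1) = commutator b a \<otimes> c" "commutator (b \<otimes> c) (1 \<otimes> a) = b \<otimes> commutator c a"
  by (simp_all add: commutator_def tens_simps)

lemmas y_lin = clinear_simps[OF clinear_yX] clinear_simps[OF clinear_yJ]

lemma yJX_comm: "commutator (yJ x) (yX y) = yJ (lie x y)"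
  by (simp add: commutator_anti[of "yX y" "yJ x", symmetric] lie_anti[of x y] y_lin yXJ_comm
      commutator_anti[of "yJ x" "yX y"])

definition hh :: "sl3 \<Rightarrow> (yangian, yangian) tensor" where
  "hh x = (1/2) *\<^sub>C commutator (yX x \<otimes> 1) Omega"

lemma hh1: "hh x = (1/2) *\<^sub>C (\<Sum>\<alpha><8. yX (lie x (onb \<alpha>)) \<otimes> yX (onb \<alpha>))"
  by (simp add: hh_def Omega_def commutator_sum_right commutator_tens yX_comm)

lemma hh2: "hh x = - ((1/2) *\<^sub>C (\<Sum>\<alpha><8. yX (onb \<alpha>) \<otimes> yX (lie x (onb \<alpha>))))"
proof -
  have "bilin (\<lambda>p q. yX p \<otimes> yX q)"
    by (rule bilinI) (simp_all add: y_lin tens_simps)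
  from onb_invariant[OF this, of x] show ?thesis by (simp add: hh1 scaleC_minus_right)
qed

lemma clinear_hh: "clinear hh"
  by (simp add: clinear_def hh1 lie_simps y_lin tens_simps sum.distrib scaleC_simps
      scaleC_sum_right mult.commute)

lemma comm_X_Omega: "commutator (coproduct_X x) Omega = 0"
proof -
  have "commutator (coproduct_X x) Omega = (\<Sum>\<alpha><8. yX (lie x (onb \<alpha>)) \<otimes> yX (onb \<alpha>))
     + (\<Sum>\<alpha><8. yX (onb \<alpha>) \<otimes> yX (lie x (onb \<alpha>)))"
    by (simp add: coproduct_X_def Omega_def commutator_simps commutator_sum_right commutator_tens
        yX_comm sum.distrib)
  also have "\<dots> = 0"
  proof -
    have "bilin (\<lambda>p q. yX p \<otimes> yX q)"
      by (rule bilinI) (simp_all add: y_lin tens_simps)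
    from onb_invariant[OF this, of x] show ?thesis by simp
  qed
  finally show ?thesis .
qed

lemma commutator_jacobi:
  "commutator a (commutator b c) = commutator (commutator a b) c + commutator b (commutator a c)"
  by (simp add: commutator_def algebra_simps)

lemma commutator_zero [simp]: "commutator a 1 = (0 :: 'a :: complex_algebra)"
  "commutator 1 a = (0 :: 'a :: complex_algebra)" "commutator a 0 = 0" "commutator 0 a = 0"
  by (simp_all add: commutator_def)

lemma comm_X_hh: "commutator (coproduct_X x) (hh y) = hh (lie x y)"
proof -
  have "commutator (coproduct_X x) (yX y \<otimes> 1) = yX (lie x y) \<otimes> 1"
    by (simp add: coproduct_X_def commutator_simps commutator_tens yX_comm
        clinear_zero[OF clinear_tens_left])
  then show ?thesis
    by (simp add: hh_def commutator_simps commutator_jacobi[of "coproduct_X x"] comm_X_Omega)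
qed

lemma comm_J_hh:
  "commutator (yJ x \<otimes> 1) (hh w) + commutator (hh x) (yJ w \<otimes> 1)
     + commutator (1 \<otimes> yJ x) (hh w) + commutator (hh x) (1 \<otimes> yJ w)
   = (1/2) *\<^sub>C ((\<Sum>\<alpha><8. yJ (lie (lie x w) (onb \<alpha>)) \<otimes> yX (onb \<alpha>))
       - (\<Sum>\<alpha><8. yX (onb \<alpha>) \<otimes> yJ (lie (lie x w) (onb \<alpha>))))"
proof -
  have a: "lie (lie p q) r = - lie r (lie p q)" for p q r by (rule lie_anti)
  have 1: "commutator (yJ x \<otimes> 1) (hh w) + commutator (hh x) (yJ w \<otimes> 1)
     = (1/2) *\<^sub>C (\<Sum>\<alpha><8. yJ (lie (lie x w) (onb \<alpha>)) \<otimes> yX (onb \<alpha>))"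
    by (simp add: hh1 commutator_simps commutator_sum_left commutator_sum_right commutator_tens
        yJX_comm yXJ_comm jacobi'[of x w] a[of x _ w] y_lin tens_simps sum_negf sum_subtractf scaleC_simps)
  have 2: "commutator (1 \<otimes> yJ x) (hh w) + commutator (hh x) (1 \<otimes> yJ w)
     = - ((1/2) *\<^sub>C (\<Sum>\<alpha><8. yX (onb \<alpha>) \<otimes> yJ (lie (lie x w) (onb \<alpha>))))"
    by (simp add: hh2 scaleC_minus_left[symmetric] commutator_simps commutator_sum_left
        commutator_sum_right commutator_tens
        yJX_comm yXJ_comm jacobi'[of x w] a[of x _ w] y_lin tens_simps sum_negf sum_subtractf)
      (simp add: scaleC_simps)
  show ?thesis using 1 2 by (simp add: add.assoc scaleC_diff_right) 
qed


lemma halve: "u + u = v \<Longrightarrow> u = (1/2) *\<^sub>C (v :: 'a :: complex_vector)"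
  using scaleC_add_left[of "1/2" "1/2" u] by (auto simp: scaleC_add_right scaleC_one)

definition anticomm :: "'a :: ring \<Rightarrow> 'a \<Rightarrow> 'a" where
  "anticomm a b = a * b + b * a"

lemma anticomm_simps:
  "anticomm (a + b) c = anticomm a c + anticomm b c"
  "anticomm a (b + c) = anticomm a b + anticomm a c"
  "anticomm (t *\<^sub>C x) y = t *\<^sub>C anticomm x y"
  "anticomm x (t *\<^sub>C y) = t *\<^sub>C anticomm x y"
  for a b c :: "'b :: ring" and x y :: "'a :: complex_algebra"
  by (auto simp: anticomm_def algebra_simps scaleC_simps)

lemma comm_tens_tens:
  "commutator (p \<otimes> a) (q \<otimes> b) = (1/2) *\<^sub>C (commutator p q \<otimes> anticomm a b + anticomm p q \<otimes> commutator a b)"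
  by (rule halve) (simp add: commutator_def anticomm_def tens_simps algebra_simps)

lemma comm_hh_hh:
  "commutator (hh x) (hh w) = (1/8) *\<^sub>C (\<Sum>\<alpha><8. \<Sum>\<beta><8.
      yX (lie (lie x (onb \<alpha>)) (lie w (onb \<beta>))) \<otimes> anticomm (yX (onb \<alpha>)) (yX (onb \<beta>))
    + anticomm (yX (onb \<alpha>)) (yX (onb \<beta>)) \<otimes> yX (lie (lie x (onb \<alpha>)) (lie w (onb \<beta>))))"
proof -
  define Q where "Q = (\<lambda>\<beta>. yX (lie w (onb \<beta>)))"
  have "commutator (hh x) (hh w) = (1/4) *\<^sub>C (\<Sum>\<beta><8. \<Sum>\<alpha><8. (1/2) *\<^sub>C (
      yX (lie (lie x (onb \<alpha>)) (lie w (onb \<beta>))) \<otimes> anticomm (yX (onb \<alpha>)) (yX (onb \<beta>))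
    + anticomm (yX (lie x (onb \<alpha>))) (Q \<beta>) \<otimes> yX (lie (onb \<alpha>) (onb \<beta>))))"
    unfolding hh1 commutator_simps commutator_sum_left commutator_sum_right comm_tens_tens yX_comm Q_def
    by (simp add: scaleC_sum_right[symmetric] scaleC_scaleC)
  also have "\<dots> = (1/8) *\<^sub>C ((\<Sum>\<beta><8. \<Sum>\<alpha><8. yX (lie (lie x (onb \<alpha>)) (lie w (onb \<beta>))) \<otimes> anticomm (yX (onb \<alpha>)) (yX (onb \<beta>)))
    + (\<Sum>\<beta><8. \<Sum>\<alpha><8. anticomm (yX (lie x (onb \<alpha>))) (Q \<beta>) \<otimes> yX (lie (onb \<alpha>) (onb \<beta>))))"
    by (simp add: scaleC_sum_right[symmetric] scaleC_scaleC sum.distrib)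
  also have "(\<Sum>\<beta><8. \<Sum>\<alpha><8. anticomm (yX (lie x (onb \<alpha>))) (Q \<beta>) \<otimes> yX (lie (onb \<alpha>) (onb \<beta>)))
     = (\<Sum>\<beta><8. - (\<Sum>\<alpha><8. anticomm (yX (onb \<alpha>)) (Q \<beta>) \<otimes> yX (lie (lie x (onb \<alpha>)) (onb \<beta>))))"
  proof (rule sum.cong[OF refl])
    fix \<beta>
    have "bilin (\<lambda>p q. anticomm (yX p) (Q \<beta>) \<otimes> yX (lie q (onb \<beta>)))"
      by (rule bilinI) (simp_all add: y_lin tens_simps anticomm_simps lie_simps)
    then show "(\<Sum>\<alpha><8. anticomm (yX (lie x (onb \<alpha>))) (Q \<beta>) \<otimes> yX (lie (onb \<alpha>) (onb \<beta>)))
     = - (\<Sum>\<alpha><8. anticomm (yX (onb \<alpha>)) (Q \<beta>) \<otimes> yX (lie (lie x (onb \<alpha>)) (onb \<beta>)))"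
      by (rule onb_invariant)
  qed
  also have "\<dots> = (\<Sum>\<alpha><8. - (\<Sum>\<beta><8. anticomm (yX (onb \<alpha>)) (Q \<beta>) \<otimes> yX (lie (lie x (onb \<alpha>)) (onb \<beta>))))"
    unfolding sum_negf by (subst sum.swap) (rule refl)
  also have "\<dots> = (\<Sum>\<alpha><8. \<Sum>\<beta><8. anticomm (yX (onb \<alpha>)) (yX (onb \<beta>)) \<otimes> yX (lie (lie x (onb \<alpha>)) (lie w (onb \<beta>))))"
  proof (rule sum.cong[OF refl])
    fix \<alpha>
    have "bilin (\<lambda>p q. anticomm (yX (onb \<alpha>)) (yX p) \<otimes> yX (lie (lie x (onb \<alpha>)) q))"
      by (rule bilinI) (simp_all add: y_lin tens_simps anticomm_simps lie_simps)
    from onb_invariant[OF this, of w]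
    show "- (\<Sum>\<beta><8. anticomm (yX (onb \<alpha>)) (Q \<beta>) \<otimes> yX (lie (lie x (onb \<alpha>)) (onb \<beta>)))
     = (\<Sum>\<beta><8. anticomm (yX (onb \<alpha>)) (yX (onb \<beta>)) \<otimes> yX (lie (lie x (onb \<alpha>)) (lie w (onb \<beta>))))"
      by (simp add: Q_def)
  qed
  finally show ?thesis
    by (subst (asm) sum.swap) (simp add: sum.distrib)
qed

definition kk :: "sl3 \<Rightarrow> (yangian, yangian) tensor" where
  "kk u = (1/2) *\<^sub>C ((\<Sum>\<alpha><8. yJ (lie u (onb \<alpha>)) \<otimes> yX (onb \<alpha>)) - (\<Sum>\<alpha><8. yX (onb \<alpha>) \<otimes> yJ (lie u (onb \<alpha>))))"

lemma clinear_kk: "clinear kk"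
  by (simp add: clinear_def kk_def lie_simps y_lin tens_simps sum.distrib scaleC_simps
      scaleC_sum_right mult.commute algebra_simps)

lemma comm_coproduct_J:
  "commutator (coproduct_J x) (coproduct_J w) = commutator (yJ x) (yJ w) \<otimes> 1 + 1 \<otimes> commutator (yJ x) (yJ w)
     + kk (lie x w) + commutator (hh x) (hh w)"
proof -
  have "coproduct_J x = yJ x \<otimes> 1 + 1 \<otimes> yJ x + hh x" for x
    by (simp add: coproduct_J_def hh_def)
  then show ?thesis
    unfolding kk_def comm_J_hh[symmetric]
    by (simp add: commutator_simps commutator_tens clinear_zero[OF clinear_tens_left]
        clinear_zero[OF clinear_tens_right] add_ac)
qed

lemma sym3_coproduct_X:
  "sym3 (coproduct_X x) (coproduct_X y) (coproduct_X z) = sym3 (yX x) (yX y) (yX z) \<otimes> 1 + 1 \<otimes> sym3 (yX x) (yX y) (yX z)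
   + (1/8) *\<^sub>C (yX x \<otimes> anticomm (yX y) (yX z) + yX y \<otimes> anticomm (yX x) (yX z) + yX z \<otimes> anticomm (yX x) (yX y))
   + (1/8) *\<^sub>C (anticomm (yX y) (yX z) \<otimes> yX x + anticomm (yX x) (yX z) \<otimes> yX y + anticomm (yX x) (yX y) \<otimes> yX z)"
proof -
  have 8: "(1/8) *\<^sub>C v = (1/24) *\<^sub>C (v + v + v)" for v :: "(yangian, yangian) tensor"
    using scaleC_add_left[of "1/24" "1/24" v] scaleC_add_left[of "1/12" "1/24" v]
    by (simp add: scaleC_add_right)
  show ?thesis
    unfolding 8 sym3_def clinear_scale[OF clinear_tens_left] clinear_scale[OF clinear_tens_right]
      scaleC_add_right[symmetric] coproduct_X_def anticomm_def
    by (rule arg_cong[where f = "scaleC _"]) (simp add: tens_simps algebra_simps)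
qed

lemma coproduct_relations: "yangian_relators coproduct_X coproduct_J \<subseteq> {0}"
  unfolding yangian_relators_vanish_iff
proof (intro conjI allI)
  show lX: "clinear coproduct_X"
    by (simp add: clinear_def coproduct_X_def y_lin tens_simps scaleC_simps add_ac)
  have J: "coproduct_J x = yJ x \<otimes> 1 + 1 \<otimes> yJ x + hh x" for x
    by (simp add: coproduct_J_def hh_def)
  then show "clinear coproduct_J"
    by (simp add: clinear_def y_lin tens_simps scaleC_simps add_ac clinear_simps[OF clinear_hh])
  fix x y z
  show "commutator (coproduct_X x) (coproduct_X y) = coproduct_X (lie x y)"
    by (simp add: coproduct_X_def commutator_simps commutator_tens yX_comm
        clinear_zero[OF clinear_tens_left] clinear_zero[OF clinear_tens_right])
  show "commutator (coproduct_X x) (coproduct_J y) = coproduct_J (lie x y)"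
    unfolding J commutator_simps comm_X_hh
    by (simp add: coproduct_X_def commutator_simps commutator_tens yXJ_comm
        clinear_zero[OF clinear_tens_left] clinear_zero[OF clinear_tens_right])
  define C where "C = (\<lambda>\<alpha> \<beta> \<gamma>. form (lie x (onb \<alpha>)) (lie (lie y (onb \<beta>)) (lie z (onb \<gamma>))))"
  define R where "R = (\<Sum>\<alpha><8. \<Sum>\<beta><8. \<Sum>\<gamma><8. C \<alpha> \<beta> \<gamma> *\<^sub>C sym3 (yX (onb \<alpha>)) (yX (onb \<beta>)) (yX (onb \<gamma>)))"
  have yJ: "commutator (yJ x) (yJ (lie y z)) + commutator (yJ z) (yJ (lie x y)) + commutator (yJ y) (yJ (lie z x)) = R"
    unfolding R_def C_def by (rule yJ_comm)
  have kk: "kk (lie x (lie y z)) + kk (lie z (lie x y)) + kk (lie y (lie z x)) = 0"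
    by (simp add: clinear_add[OF clinear_kk, symmetric] jacobi clinear_zero[OF clinear_kk])
  define G1 where "G1 = (\<lambda>u p q. yX u \<otimes> anticomm (yX p) (yX q))"
  define G2 where "G2 = (\<lambda>u p q. anticomm (yX p) (yX q) \<otimes> yX u)"
  have G: "clinear (\<lambda>u. G1 u p q)" "clinear (\<lambda>u. G2 u p q)" "G1 u p q = G1 u q p" "G2 u p q = G2 u q p" for u p q
    by (auto simp: G1_def G2_def clinear_def y_lin tens_simps anticomm_def add.commute scaleC_simps)
  have hh: "commutator (hh x) (hh w) = (1/8) *\<^sub>C (\<Sum>\<alpha><8. \<Sum>\<beta><8.
      G1 (lie (lie x (onb \<alpha>)) (lie w (onb \<beta>))) (onb \<alpha>) (onb \<beta>)) +
      (1/8) *\<^sub>C (\<Sum>\<alpha><8. \<Sum>\<beta><8. G2 (lie (lie x (onb \<alpha>)) (lie w (onb \<beta>))) (onb \<alpha>) (onb \<beta>))" for x w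
    by (simp add: comm_hh_hh G1_def G2_def sum.distrib scaleC_add_right)
  have "commutator (coproduct_J x) (coproduct_J (lie y z)) + commutator (coproduct_J z) (coproduct_J (lie x y))
        + commutator (coproduct_J y) (coproduct_J (lie z x))
     = (commutator (yJ x) (yJ (lie y z)) + commutator (yJ z) (yJ (lie x y)) + commutator (yJ y) (yJ (lie z x))) \<otimes> 1
     + 1 \<otimes> (commutator (yJ x) (yJ (lie y z)) + commutator (yJ z) (yJ (lie x y)) + commutator (yJ y) (yJ (lie z x)))
     + (kk (lie x (lie y z)) + kk (lie z (lie x y)) + kk (lie y (lie z x)))
     + (commutator (hh x) (hh (lie y z)) + commutator (hh z) (hh (lie x y)) + commutator (hh y) (hh (lie z x)))"
    unfolding comm_coproduct_J tens_simps by (simp add: add_ac)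
  also have "\<dots> = R \<otimes> 1 + 1 \<otimes> R
     + (commutator (hh x) (hh (lie y z)) + commutator (hh z) (hh (lie x y)) + commutator (hh y) (hh (lie z x)))"
    unfolding yJ kk by simp
  also have "commutator (hh x) (hh (lie y z)) + commutator (hh z) (hh (lie x y)) + commutator (hh y) (hh (lie z x))
    = (1/8) *\<^sub>C (\<Sum>\<alpha><8. \<Sum>\<beta><8. \<Sum>\<gamma><8. C \<alpha> \<beta> \<gamma> *\<^sub>C
            (G1 (onb \<alpha>) (onb \<beta>) (onb \<gamma>) + G1 (onb \<beta>) (onb \<alpha>) (onb \<gamma>) + G1 (onb \<gamma>) (onb \<alpha>) (onb \<beta>)))
    + (1/8) *\<^sub>C (\<Sum>\<alpha><8. \<Sum>\<beta><8. \<Sum>\<gamma><8. C \<alpha> \<beta> \<gamma> *\<^sub>C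
            (G2 (onb \<alpha>) (onb \<beta>) (onb \<gamma>) + G2 (onb \<beta>) (onb \<alpha>) (onb \<gamma>) + G2 (onb \<gamma>) (onb \<alpha>) (onb \<beta>)))"
    unfolding C_def onb_terrific[of G1 x y z, OF G(1,3)] onb_terrific[of G2 x y z, OF G(2,4)] hh
    by (simp add: sum.distrib scaleC_add_right add_ac)
  also have "R \<otimes> 1 + 1 \<otimes> R + \<dots> = (\<Sum>\<alpha><8. \<Sum>\<beta><8. \<Sum>\<gamma><8. C \<alpha> \<beta> \<gamma> *\<^sub>C
        (sym3 (yX (onb \<alpha>)) (yX (onb \<beta>)) (yX (onb \<gamma>)) \<otimes> 1 + 1 \<otimes> sym3 (yX (onb \<alpha>)) (yX (onb \<beta>)) (yX (onb \<gamma>))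
        + (1/8) *\<^sub>C (G1 (onb \<alpha>) (onb \<beta>) (onb \<gamma>) + G1 (onb \<beta>) (onb \<alpha>) (onb \<gamma>) + G1 (onb \<gamma>) (onb \<alpha>) (onb \<beta>))
        + (1/8) *\<^sub>C (G2 (onb \<alpha>) (onb \<beta>) (onb \<gamma>) + G2 (onb \<beta>) (onb \<alpha>) (onb \<gamma>) + G2 (onb \<gamma>) (onb \<alpha>) (onb \<beta>))))"
    unfolding R_def clinear_sum[OF clinear_tens_left] clinear_sum[OF clinear_tens_right]
      clinear_scale[OF clinear_tens_left] clinear_scale[OF clinear_tens_right] scaleC_sum_right
      sum.distrib[symmetric]
    by (intro sum.cong refl) (simp add: scaleC_simps mult.commute add_ac)
  also have "\<dots> = (\<Sum>\<alpha><8. \<Sum>\<beta><8. \<Sum>\<gamma><8. C \<alpha> \<beta> \<gamma> *\<^sub>C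
        sym3 (coproduct_X (onb \<alpha>)) (coproduct_X (onb \<beta>)) (coproduct_X (onb \<gamma>)))"
    unfolding sym3_coproduct_X G1_def G2_def by (rule refl)
  finally show "commutator (coproduct_J x) (coproduct_J (lie y z)) + commutator (coproduct_J z) (coproduct_J (lie x y))
        + commutator (coproduct_J y) (coproduct_J (lie z x)) = (\<Sum>\<alpha><8. \<Sum>\<beta><8. \<Sum>\<gamma><8.
        form (lie x (onb \<alpha>)) (lie (lie y (onb \<beta>)) (lie z (onb \<gamma>))) *\<^sub>C
        sym3 (coproduct_X (onb \<alpha>)) (coproduct_X (onb \<beta>)) (coproduct_X (onb \<gamma>)))"
    unfolding C_def .
qed

lift_definition coproduct :: "yangian \<Rightarrow> (yangian, yangian) tensor"
  is "free_lift (yangian_gen_val coproduct_X coproduct_J)"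
  by (rule free_lift_respects[OF coproduct_relations])

lemma coproduct_yX: "coproduct (yX x) = yX x \<otimes> 1 + 1 \<otimes> yX x"
  by (simp add: coproduct.abs_eq yX.abs_eq yangian_gen_val_def coproduct_X_def)

lemma coproduct_yJ:
  "coproduct (yJ x) = yJ x \<otimes> 1 + 1 \<otimes> yJ x + (1/2) *\<^sub>C commutator (yX x \<otimes> 1) Omega"
  by (simp add: coproduct.abs_eq yJ.abs_eq yangian_gen_val_def coproduct_J_def)

lemma alg_hom_yangianI:
  assumes f: "\<And>s. f (abs_yangian s) = free_lift g s"
  shows "alg_hom f"
proof -
  have ex: "\<exists>s. x = abs_yangian s" for x
    by (metis Quotient3_abs_rep[OF Quotient3_yangian])
  have 1: "f (x + y) = f x + f y" "f (x * y) = f x * f y" "f (c *\<^sub>C x) = c *\<^sub>C f x" for x y c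
  proof -
    obtain s t where st: "x = abs_yangian s" "y = abs_yangian t" using ex by metis
    show "f (x + y) = f x + f y" "f (x * y) = f x * f y" "f (c *\<^sub>C x) = c *\<^sub>C f x"
      unfolding st alg_hom_simps[OF alg_hom_abs_yangian, symmetric] f
      by (simp_all add: alg_hom_simps[OF alg_hom_free_lift])
  qed
  have "f 1 = 1"
    unfolding alg_hom_one[OF alg_hom_abs_yangian, symmetric] f by (rule alg_hom_one[OF alg_hom_free_lift])
  with 1 show ?thesis by (simp add: alg_hom_def clinear_def)
qed

lemma alg_hom_coproduct: "alg_hom coproduct"
  by (rule alg_hom_yangianI) (rule coproduct.abs_eq)


section \<open>Modules\<close>

text \<open>A Yangian module structure on \<^typ>\<open>complex^'n\<close>, given by its representation map.\<close>

lemma zero_relations: "yangian_relators (\<lambda>x. 0) (\<lambda>x. 0) \<subseteq> {0}"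
  by (simp add: yangian_relators_vanish_iff clinear_def sym3_def)

lift_definition zero_action :: "yangian \<Rightarrow> 'a :: complex_algebra"
  is "free_lift (yangian_gen_val (\<lambda>x. 0) (\<lambda>x. 0))"
  by (rule free_lift_respects[OF zero_relations])

typedef 'n yangian_module = "{\<rho> :: yangian \<Rightarrow> 'n::finite cmatrix. alg_hom \<rho>}"
  morphisms repr Yangian_module
  using alg_hom_yangianI[OF zero_action.abs_eq] by blast

setup_lifting type_definition_yangian_module

lemma alg_hom_repr: "alg_hom (repr M)"
  using repr[of M] by simp

definition act :: "'n::finite yangian_module \<Rightarrow> yangian \<Rightarrow> complex^'n \<Rightarrow> complex^'n" where
  "act M y v = mat_of (repr M y) *v v"


subsection \<open>Tensor product of modules\<close>

text \<open>The tensor product of \<^typ>\<open>complex^'n\<close> and \<^typ>\<open>complex^'m\<close> is \<^typ>\<open>complex^('n \<times> 'm)\<close>.\<close>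

definition tensor_vec :: "complex^'n \<Rightarrow> complex^'m \<Rightarrow> complex^('n \<times> 'm)" where
  "tensor_vec v w = (\<chi> r. v $ fst r * w $ snd r)"

lift_definition kronecker :: "'n::finite cmatrix \<Rightarrow> 'm::finite cmatrix \<Rightarrow> ('n \<times> 'm) cmatrix"
  is "\<lambda>A B. \<chi> r s. A $ fst r $ fst s * B $ snd r $ snd s" .

lemma entry_kronecker: "entry (kronecker A B) r s = entry A (fst r) (fst s) * entry B (snd r) (snd s)"
  by transfer simp

lemma kronecker_simps:
  "kronecker (A + A') B = kronecker A B + kronecker A' B"
  "kronecker A (B + B') = kronecker A B + kronecker A B'"
  "kronecker (c *\<^sub>C A) B = c *\<^sub>C kronecker A B" "kronecker A (c *\<^sub>C B) = c *\<^sub>C kronecker A B"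
  "kronecker 1 1 = 1"
  by (auto intro!: cmatrix_eqI simp: entry_kronecker algebra_simps prod_eq_iff)

lemma kronecker_mult: "kronecker A B * kronecker A' B' = kronecker (A * A') (B * B')"
  by (rule cmatrix_eqI)
     (simp add: entry_kronecker entry_mult UNIV_Times_UNIV[symmetric] sum.cartesian_product' sum_product
        mult_ac del: UNIV_Times_UNIV)

lemma kronecker_tensor_vec:
  "mat_of (kronecker A B) *v tensor_vec v w = tensor_vec (mat_of A *v v) (mat_of B *v w)"
  by (simp add: vec_eq_iff kronecker.rep_eq tensor_vec_def matrix_vector_mult_def
        UNIV_Times_UNIV[symmetric] sum.cartesian_product' sum_product mult_ac del: UNIV_Times_UNIV)

text \<open>The algebra homomorphism \<open>a \<otimes> b \<mapsto> M(a) \<otimes> N(b)\<close>; independence of the representative chosen by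
  \<^const>\<open>rep_tensor\<close> is \<open>tensor_repr_abs\<close> below.\<close>

definition tensor_repr ::
  "'n::finite yangian_module \<Rightarrow> 'm::finite yangian_module \<Rightarrow> (yangian, yangian) tensor \<Rightarrow> ('n \<times> 'm) cmatrix"
  where "tensor_repr M N t = free_lift (\<lambda>(a, b). kronecker (repr M a) (repr N b)) (rep_tensor t)"

lemma tensor_repr_abs:
  "tensor_repr M N (abs_tensor s) = free_lift (\<lambda>(a, b). kronecker (repr M a) (repr N b)) s"
  unfolding tensor_repr_def
proof (rule ideal_cong_hom[OF alg_hom_free_lift])
  show "ideal_cong tensor_relators (rep_tensor (abs_tensor s)) s"
    using Quotient3_rep_abs[OF Quotient3_tensor] ideal_cong_refl by blast
qed (auto simp: tensor_relators_def alg_hom_simps[OF alg_hom_free_lift]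
       alg_hom_simps[OF alg_hom_repr] kronecker_simps kronecker_mult)

lemma tensor_repr_tens: "tensor_repr M N (a \<otimes> b) = kronecker (repr M a) (repr N b)"
  by (simp add: tens.abs_eq tensor_repr_abs)

lemma alg_hom_tensor_repr: "alg_hom (tensor_repr M N)"
proof -
  define g where "g = (\<lambda>(a, b). kronecker (repr M a) (repr N b))"
  have f: "tensor_repr M N (abs_tensor s) = free_lift g s" for s
    by (simp add: tensor_repr_abs g_def)
  have ex: "\<exists>s. x = abs_tensor s" for x :: "(yangian, yangian) tensor"
    by (metis Quotient3_abs_rep[OF Quotient3_tensor])
  have "tensor_repr M N (x + y) = tensor_repr M N x + tensor_repr M N y"
    "tensor_repr M N (x * y) = tensor_repr M N x * tensor_repr M N y"
    "tensor_repr M N (c *\<^sub>C x) = c *\<^sub>C tensor_repr M N x" for x y c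
  proof -
    obtain s t where st: "x = abs_tensor s" "y = abs_tensor t" using ex by metis
    show "tensor_repr M N (x + y) = tensor_repr M N x + tensor_repr M N y"
      "tensor_repr M N (x * y) = tensor_repr M N x * tensor_repr M N y"
      "tensor_repr M N (c *\<^sub>C x) = c *\<^sub>C tensor_repr M N x"
      unfolding st plus_tensor.abs_eq times_tensor.abs_eq scaleC_tensor.abs_eq f
      by (simp_all add: alg_hom_simps[OF alg_hom_free_lift])
  qed
  moreover have "tensor_repr M N 1 = 1"
    by (simp add: tens_one[symmetric] tensor_repr_tens alg_hom_one[OF alg_hom_repr] kronecker_simps)
  ultimately show ?thesis by (simp add: alg_hom_def clinear_def)
qed

definition tensor_module ::
  "'n::finite yangian_module \<Rightarrow> 'm::finite yangian_module \<Rightarrow> ('n \<times> 'm) yangian_module" (infixr "\<otimes>\<^sub>Y" 75)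
  where "M \<otimes>\<^sub>Y N = Yangian_module (\<lambda>y. tensor_repr M N (coproduct y))"

lemma repr_tensor_module: "repr (M \<otimes>\<^sub>Y N) y = tensor_repr M N (coproduct y)"
proof -
  have "alg_hom (\<lambda>y. tensor_repr M N (coproduct y))"
    unfolding alg_hom_def clinear_def
    by (simp add: alg_hom_simps[OF alg_hom_tensor_repr] alg_hom_simps[OF alg_hom_coproduct])
  then show ?thesis by (simp add: tensor_module_def Yangian_module_inverse)
qed


subsection \<open>The vector representation and its dual\<close>

abbreviation onb_mat :: "nat \<Rightarrow> 3 cmatrix" where "onb_mat \<alpha> \<equiv> sl_mat (onb \<alpha>)"

lemma tr_one3: "tr (1 :: 3 cmatrix) = 3"
  by (simp add: tr_entry)

lemma clinear_sl_mat: "clinear sl_mat"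
  by (simp add: clinear_def sl_mat_simps)

lemma onb_mat_expand:
  "(\<Sum>\<alpha><8. tr (A * onb_mat \<alpha>) *\<^sub>C onb_mat \<alpha>) = A - (tr A / 3) *\<^sub>C 1"
proof -
  define x where "x = Sl (A - (tr A / 3) *\<^sub>C 1)"
  have x: "sl_mat x = A - (tr A / 3) *\<^sub>C 1"
    unfolding x_def by (rule Sl_inverse) (simp add: tr_one3)
  have "form x (onb \<alpha>) = tr (A * onb_mat \<alpha>)" for \<alpha>
    by (simp add: form.rep_eq x algebra_simps mult_scaleC_left)
  with onb_contract[OF clinear_sl_mat, of x] show ?thesis by (simp add: x)
qed

lemma onb_mat_entries:
  "(\<Sum>\<alpha><8. entry (onb_mat \<alpha>) s r * entry (onb_mat \<alpha>) p q)
   = of_bool (p = r \<and> q = s) - of_bool (r = s) * of_bool (p = q) / 3"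
proof -
  define E :: "3 cmatrix" where "E = Cmat (\<chi> i j. of_bool (i = r \<and> j = s))"
  have E: "entry E i j = of_bool (i = r \<and> j = s)" for i j
    by (simp add: E_def entry.rep_eq Cmat_inverse)
  have 1: "tr (E * M) = entry M s r" for M
    using exhaust_3[of r] exhaust_3[of s] by (auto simp: tr_entry entry_mult E sum_3)
  have 2: "tr E = of_bool (r = s)"
    by (simp add: tr_entry E of_bool_conj)
  show ?thesis
    using arg_cong[OF onb_mat_expand[of E], of "\<lambda>M. entry M p q"]
    by (simp add: entry_sum 1 2 E)
qed

lemma onb_mat_contract:
  "(\<Sum>\<alpha><8. a * (onb_mat \<alpha> * (b * (onb_mat \<alpha> * c)))) = tr b *\<^sub>C (a * c) - (1/3) *\<^sub>C (a * (b * c))"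
proof -
  have "(\<Sum>\<alpha><8. onb_mat \<alpha> * b * onb_mat \<alpha>) = tr b *\<^sub>C 1 - (1/3) *\<^sub>C b"
  proof (rule cmatrix_eqI)
    fix i j
    have "entry (\<Sum>\<alpha><8. onb_mat \<alpha> * b * onb_mat \<alpha>) i j
      = (\<Sum>\<alpha><8. \<Sum>k\<in>UNIV. \<Sum>l\<in>UNIV. entry b k l * (entry (onb_mat \<alpha>) i k * entry (onb_mat \<alpha>) l j))"
      by (simp add: entry_sum entry_mult sum_distrib_left sum_distrib_right mult_ac)
    also have "\<dots> = (\<Sum>k\<in>UNIV. \<Sum>\<alpha><8. \<Sum>l\<in>UNIV. entry b k l * (entry (onb_mat \<alpha>) i k * entry (onb_mat \<alpha>) l j))"
      by (rule sum.swap)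
    also have "\<dots> = (\<Sum>k\<in>UNIV. \<Sum>l\<in>UNIV. \<Sum>\<alpha><8. entry b k l * (entry (onb_mat \<alpha>) i k * entry (onb_mat \<alpha>) l j))"
      by (intro sum.cong refl sum.swap)
    also have "\<dots> = (\<Sum>k\<in>UNIV. \<Sum>l\<in>UNIV. entry b k l * (of_bool (l = k \<and> j = i) - of_bool (k = i) * of_bool (l = j) / 3))"
      by (simp add: sum_distrib_left[symmetric] onb_mat_entries)
    also have "\<dots> = entry (tr b *\<^sub>C 1 - (1/3) *\<^sub>C b) i j"
      using exhaust_3[of i] exhaust_3[of j] by (auto simp: sum_3 tr_entry)
    finally show "entry (\<Sum>\<alpha><8. onb_mat \<alpha> * b * onb_mat \<alpha>) i j = entry (tr b *\<^sub>C 1 - (1/3) *\<^sub>C b) i j" .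
  qed
  then have "a * (\<Sum>\<alpha><8. onb_mat \<alpha> * b * onb_mat \<alpha>) * c = a * (tr b *\<^sub>C 1 - (1/3) *\<^sub>C b) * c"
    by simp
  then show ?thesis
    by (simp add: sum_distrib_left sum_distrib_right mult.assoc algebra_simps scaleC_simps)
qed


text \<open>The right-hand side of the last defining relation vanishes on the vector representation,
  which is why \<open>J(x)\<close> may act as \<open>c x\<close>.\<close>

lemma sym3_vector_vanish:
  "(\<Sum>\<alpha><8. \<Sum>\<beta><8. \<Sum>\<gamma><8. form (lie x' (onb \<alpha>)) (lie (lie y' (onb \<beta>)) (lie z' (onb \<gamma>))) *\<^sub>C
      sym3 (onb_mat \<alpha>) (onb_mat \<beta>) (onb_mat \<gamma>)) = 0"
proof -
  define x y z where xyz: "x = sl_mat x'" "y = sl_mat y'" "z = sl_mat z'"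
  have tr0 [simp]: "tr x = 0" "tr y = 0" "tr z = 0" by (simp_all add: xyz)
  define W where "W = (\<lambda>a b c :: 3 cmatrix. a*b*c + a*c*b + b*a*c + b*c*a + c*a*b + c*b*a)"
  define K where "K = (\<lambda>u v g :: 3 cmatrix. tr v *\<^sub>C anticomm u g + tr u *\<^sub>C anticomm v g + tr (v * g) *\<^sub>C u + tr (u * g) *\<^sub>C v)"
  have A: "(\<Sum>\<beta><8. W (u * (onb_mat \<beta> * v)) (onb_mat \<beta>) g) = K u v g - anticomm (u * v) g" for u v g
  proof -
    note c = onb_mat_contract
    have "(\<Sum>\<beta><8. W (u * (onb_mat \<beta> * v)) (onb_mat \<beta>) g)
      = (\<Sum>\<beta><8. u * (onb_mat \<beta> * (v * (onb_mat \<beta> * g)))) + (\<Sum>\<beta><8. u * (onb_mat \<beta> * ((v * g) * (onb_mat \<beta> * 1))))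
      + (\<Sum>\<beta><8. 1 * (onb_mat \<beta> * (u * (onb_mat \<beta> * (v * g))))) + (\<Sum>\<beta><8. 1 * (onb_mat \<beta> * ((g * u) * (onb_mat \<beta> * v))))
      + (\<Sum>\<beta><8. (g * u) * (onb_mat \<beta> * (v * (onb_mat \<beta> * 1)))) + (\<Sum>\<beta><8. g * (onb_mat \<beta> * (u * (onb_mat \<beta> * v))))"
      by (simp add: W_def sum.distrib[symmetric] mult.assoc add_ac)
    also have "\<dots> = K u v g - (1/3 + 1/3 + 1/3) *\<^sub>C anticomm (u * v) g"
      unfolding c by (simp only: scaleC_add_left)
        (simp add: K_def anticomm_def algebra_simps scaleC_simps tr_mult_comm[of g u])
    finally show ?thesis by (simp add: scaleC_one)
  qed
  have Wlin: "W (a + b) c d = W a c d + W b c d" "W (a - b) c d = W a c d - W b c d" for a b c d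
    by (simp_all add: W_def algebra_simps)
  have Klin: "K (a + b) v g = K a v g + K b v g" "K (a - b) v g = K a v g - K b v g"
    "K v (a + b) g = K v a g + K v b g" "K v (a - b) g = K v a g - K v b g" "K v a g = K a v g" for a b v g
    by (simp_all add: K_def anticomm_def algebra_simps scaleC_simps scaleC_add_left scaleC_diff_left)
  have B: "(\<Sum>\<beta><8. W (commutator (commutator (commutator y (onb_mat \<beta>)) D) x) (onb_mat \<beta>) g)
     = K y (commutator D x) g + K x (commutator y D) g + K D (commutator y x) g + K 1 (x * (D * y) - y * (D * x)) g" for D g
  proof -
    have "commutator (commutator (commutator y b) D) x
        = y * (b * (D * x)) - 1 * (b * (y * (D * x))) - (D * y) * (b * x) + D * (b * (y * x))
        - (x * y) * (b * D) + x * (b * (y * D)) + (x * (D * y)) * (b * 1) - (x * D) * (b * y)" for b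
      by (simp add: commutator_def algebra_simps)
    then have "(\<Sum>\<beta><8. W (commutator (commutator (commutator y (onb_mat \<beta>)) D) x) (onb_mat \<beta>) g)
      = K y (D * x) g - K 1 (y * (D * x)) g - K (D * y) x g + K D (y * x) g - K (x * y) D g + K x (y * D) g
       + K (x * (D * y)) 1 g - K (x * D) y g
       - anticomm (y * (D * x) - 1 * (y * (D * x)) - (D * y) * x + D * (y * x)
        - (x * y) * D + x * (y * D) + (x * (D * y)) * 1 - (x * D) * y) g"
      by (simp only: Wlin sum.distrib sum_subtractf A) (simp add: anticomm_def algebra_simps)
    also have "\<dots> = K y (commutator D x) g + K x (commutator y D) g + K D (commutator y x) g + K 1 (x * (D * y) - y * (D * x)) g"
      unfolding commutator_def Klin(1-4)
      unfolding Klin(5)[of "D * y" x] Klin(5)[of "x * y" D] Klin(5)[of "x * (D * y)" 1] Klin(5)[of "x * D" y]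
      by (simp add: anticomm_def mult.assoc)
    finally show ?thesis .
  qed
  define D where "D = (\<lambda>\<gamma>. commutator z (onb_mat \<gamma>))"
  define q where "q = (\<lambda>\<gamma>. x * (D \<gamma> * y) - y * (D \<gamma> * x))"
  have q': "x * (D \<gamma> * y) - y * (D \<gamma> * x) = q \<gamma>" for \<gamma> by (simp add: q_def)
  have trD: "tr (D \<gamma>) = 0" "tr (D \<gamma> * onb_mat \<gamma>) = 0" for \<gamma>
    using tr_mult_comm[of "onb_mat \<gamma>" "z * onb_mat \<gamma>"]
    by (simp_all add: D_def) (simp add: commutator_def algebra_simps)
  have P1: "(\<Sum>\<gamma><8. tr (commutator (D \<gamma>) x * onb_mat \<gamma>)) = - 6 * tr (z * x)" if "tr x = 0" for x
  proof -
    have "(\<Sum>\<gamma><8. commutator (D \<gamma>) x * onb_mat \<gamma>)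
       = (\<Sum>\<gamma><8. z * (onb_mat \<gamma> * (x * (onb_mat \<gamma> * 1)))) - (\<Sum>\<gamma><8. 1 * (onb_mat \<gamma> * ((z * x) * (onb_mat \<gamma> * 1))))
        - (\<Sum>\<gamma><8. (x * z) * (onb_mat \<gamma> * (1 * (onb_mat \<gamma> * 1)))) + (\<Sum>\<gamma><8. x * (onb_mat \<gamma> * (z * (onb_mat \<gamma> * 1))))"
      by (simp add: D_def commutator_def sum.distrib[symmetric] sum_subtractf[symmetric] algebra_simps)
    then show ?thesis
      unfolding onb_mat_contract by (simp add: tr_sum[symmetric] that tr_one3 tr_mult_comm[of x z])
  qed
  have P2: "(\<Sum>\<gamma><8. tr (commutator y (D \<gamma>) * onb_mat \<gamma>)) = 6 * tr (z * y)"
    using P1[of y] by (simp add: commutator_anti[of y] sum_negf)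
  have F: "(\<Sum>\<gamma><8. tr (sl_mat w * onb_mat \<gamma>) *\<^sub>C f (onb_mat \<gamma>)) = f (sl_mat w)" if "clinear f" for w f
  proof -
    have "clinear (\<lambda>p. f (sl_mat p))"
      using that by (simp add: clinear_def sl_mat_simps)
    from onb_contract[OF this, of w] show ?thesis by (simp add: form.rep_eq)
  qed
  have lin: "clinear (\<lambda>g. commutator (commutator z g) x)" "clinear (\<lambda>g. commutator y (commutator z g))"
     "clinear (\<lambda>g. commutator z g)"
    by (simp_all add: clinear_def commutator_simps)
  have P3: "(\<Sum>\<gamma><8. tr (y * onb_mat \<gamma>) *\<^sub>C commutator (D \<gamma>) x) = commutator (commutator z y) x"
    using F[OF lin(1), of y'] by (simp add: xyz D_def)
  have P4: "(\<Sum>\<gamma><8. tr (x * onb_mat \<gamma>) *\<^sub>C commutator y (D \<gamma>)) = commutator y (commutator z x)"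
    using F[OF lin(2), of x'] by (simp add: xyz D_def)
  have P5: "(\<Sum>\<gamma><8. tr (commutator y x * onb_mat \<gamma>) *\<^sub>C D \<gamma>) = commutator z (commutator y x)"
    using F[OF lin(3), of "lie y' x'"] by (simp add: xyz D_def sl_mat_simps)
  have P7: "(\<Sum>\<gamma><8. tr (q \<gamma>) *\<^sub>C onb_mat \<gamma>) = commutator (commutator y x) z"
  proof -
    have "tr (q \<gamma>) = tr (commutator (commutator y x) z * onb_mat \<gamma>)" for \<gamma>
    proof -
      define g where "g = onb_mat \<gamma>"
      have r: "tr (a * g * b) = tr (b * a * g)" for a b
        using tr_mult_comm[of "a * g" b] by (simp add: mult.assoc)
      have "q \<gamma> = (x*z)*g*y - x*g*(z*y) - (y*z)*g*x + y*g*(z*x)"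
        by (simp add: q_def D_def g_def commutator_def algebra_simps)
      then have "tr (q \<gamma>) = tr (y*x*z*g) - tr (z*y*x*g) - tr (x*y*z*g) + tr (z*x*y*g)"
        by (simp only: tr_simps r) (simp only: mult.assoc)
      then show ?thesis by (simp add: g_def commutator_def algebra_simps)
    qed
    then show ?thesis
      using F[of "\<lambda>g. g" "lie (lie y' x') z'"] by (simp add: xyz clinear_def sl_mat_simps)
  qed
  have Q1: "(\<Sum>\<gamma><8. q \<gamma> * onb_mat \<gamma>) = tr (z * x) *\<^sub>C y - tr (z * y) *\<^sub>C x"
  proof -
    have "(\<Sum>\<gamma><8. q \<gamma> * onb_mat \<gamma>)
       = (\<Sum>\<gamma><8. (x * z) * (onb_mat \<gamma> * (y * (onb_mat \<gamma> * 1)))) - (\<Sum>\<gamma><8. x * (onb_mat \<gamma> * ((z * y) * (onb_mat \<gamma> * 1))))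
        - (\<Sum>\<gamma><8. (y * z) * (onb_mat \<gamma> * (x * (onb_mat \<gamma> * 1)))) + (\<Sum>\<gamma><8. y * (onb_mat \<gamma> * ((z * x) * (onb_mat \<gamma> * 1))))"
      by (simp add: q_def D_def commutator_def sum.distrib[symmetric] sum_subtractf[symmetric] algebra_simps)
    then show ?thesis unfolding onb_mat_contract by (simp add: algebra_simps)
  qed
  have Q2: "(\<Sum>\<gamma><8. onb_mat \<gamma> * q \<gamma>) = tr (z * x) *\<^sub>C y - tr (z * y) *\<^sub>C x"
  proof -
    have "(\<Sum>\<gamma><8. onb_mat \<gamma> * q \<gamma>)
       = (\<Sum>\<gamma><8. 1 * (onb_mat \<gamma> * ((x * z) * (onb_mat \<gamma> * y)))) - (\<Sum>\<gamma><8. 1 * (onb_mat \<gamma> * (x * (onb_mat \<gamma> * (z * y)))))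
        - (\<Sum>\<gamma><8. 1 * (onb_mat \<gamma> * ((y * z) * (onb_mat \<gamma> * x)))) + (\<Sum>\<gamma><8. 1 * (onb_mat \<gamma> * (y * (onb_mat \<gamma> * (z * x)))))"
      by (simp add: q_def D_def commutator_def sum.distrib[symmetric] sum_subtractf[symmetric] algebra_simps)
    then show ?thesis unfolding onb_mat_contract
      by (simp add: algebra_simps tr_mult_comm[of x z] tr_mult_comm[of y z])
  qed
  have P8: "(\<Sum>\<gamma><8. anticomm (q \<gamma>) (onb_mat \<gamma>)) = 2 *\<^sub>C (tr (z * x) *\<^sub>C y - tr (z * y) *\<^sub>C x)"
    using scaleC_add_left[of 1 1 "tr (z * x) *\<^sub>C y - tr (z * y) *\<^sub>C x"]
    by (simp add: anticomm_def sum.distrib Q1 Q2 scaleC_one)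
  have P9: "(\<Sum>\<gamma><8. tr (q \<gamma> * onb_mat \<gamma>)) = 0"
    by (simp add: tr_sum[symmetric] Q1)
  have two: "a + a = 2 *\<^sub>C a" for a :: "3 cmatrix"
    using scaleC_add_left[of 1 1 a] by (simp add: scaleC_one)
  have K: "K y (commutator (D \<gamma>) x) (onb_mat \<gamma>) + K x (commutator y (D \<gamma>)) (onb_mat \<gamma>)
      + K (D \<gamma>) (commutator y x) (onb_mat \<gamma>) + K 1 (q \<gamma>) (onb_mat \<gamma>)
    = tr (commutator (D \<gamma>) x * onb_mat \<gamma>) *\<^sub>C y + tr (y * onb_mat \<gamma>) *\<^sub>C commutator (D \<gamma>) x
    + tr (commutator y (D \<gamma>) * onb_mat \<gamma>) *\<^sub>C x + tr (x * onb_mat \<gamma>) *\<^sub>C commutator y (D \<gamma>)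
    + tr (commutator y x * onb_mat \<gamma>) *\<^sub>C D \<gamma>
    + 2 *\<^sub>C tr (q \<gamma>) *\<^sub>C onb_mat \<gamma> + 3 *\<^sub>C anticomm (q \<gamma>) (onb_mat \<gamma>) + tr (q \<gamma> * onb_mat \<gamma>) *\<^sub>C 1" for \<gamma>
    unfolding two[symmetric] by (simp add: K_def trD tr_one3 anticomm_def[of 1] scaleC_add_right)
  have "(\<Sum>\<beta><8. \<Sum>\<gamma><8. W (commutator (commutator (commutator y (onb_mat \<beta>)) (D \<gamma>)) x) (onb_mat \<beta>) (onb_mat \<gamma>))
    = (\<Sum>\<gamma><8. \<Sum>\<beta><8. W (commutator (commutator (commutator y (onb_mat \<beta>)) (D \<gamma>)) x) (onb_mat \<beta>) (onb_mat \<gamma>))"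
    by (rule sum.swap)
  also have "\<dots> = (- 6 * tr (z * x)) *\<^sub>C y + commutator (commutator z y) x + (6 * tr (z * y)) *\<^sub>C x + commutator y (commutator z x)
    + commutator z (commutator y x) + 2 *\<^sub>C commutator (commutator y x) z + 3 *\<^sub>C 2 *\<^sub>C (tr (z * x) *\<^sub>C y - tr (z * y) *\<^sub>C x)"
    unfolding B q' unfolding K unfolding sum.distrib
    by (simp only: scaleC_sum_left[symmetric] scaleC_sum_right[symmetric] P1[OF tr0(1)] P2 P3 P4 P5 P7 P8 P9) simp
  also have "\<dots> = commutator (commutator z y) x + commutator y (commutator z x)
    + commutator z (commutator y x) + (commutator (commutator y x) z + commutator (commutator y x) z)"
    unfolding two by (simp add: scaleC_simps)
  also have "\<dots> = 0"
    by (simp add: commutator_def algebra_simps)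
  finally have W0: "(\<Sum>\<beta><8. \<Sum>\<gamma><8. W (commutator (commutator (commutator y (onb_mat \<beta>)) (D \<gamma>)) x) (onb_mat \<beta>) (onb_mat \<gamma>)) = 0" .
  have C: "form (lie x' a) (lie b c) = form (lie (lie b c) x') a" for a b c
    by (metis form_lie form_sym)
  have slin: "clinear (\<lambda>p. sym3 (sl_mat p) b c)" for b c
    by (simp add: clinear_def sym3_def sl_mat_simps algebra_simps scaleC_simps)
  have "(\<Sum>\<alpha><8. \<Sum>\<beta><8. \<Sum>\<gamma><8. form (lie x' (onb \<alpha>)) (lie (lie y' (onb \<beta>)) (lie z' (onb \<gamma>))) *\<^sub>C
      sym3 (onb_mat \<alpha>) (onb_mat \<beta>) (onb_mat \<gamma>))
    = (\<Sum>\<beta><8. \<Sum>\<alpha><8. \<Sum>\<gamma><8. form (lie x' (onb \<alpha>)) (lie (lie y' (onb \<beta>)) (lie z' (onb \<gamma>))) *\<^sub>C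
      sym3 (onb_mat \<alpha>) (onb_mat \<beta>) (onb_mat \<gamma>))"
    by (rule sum.swap)
  also have "\<dots> = (\<Sum>\<beta><8. \<Sum>\<gamma><8. \<Sum>\<alpha><8. form (lie x' (onb \<alpha>)) (lie (lie y' (onb \<beta>)) (lie z' (onb \<gamma>))) *\<^sub>C
      sym3 (onb_mat \<alpha>) (onb_mat \<beta>) (onb_mat \<gamma>))"
    by (intro sum.cong refl sum.swap)
  also have "\<dots> = (\<Sum>\<beta><8. \<Sum>\<gamma><8. (1/24) *\<^sub>C W (commutator (commutator (commutator y (onb_mat \<beta>)) (D \<gamma>)) x) (onb_mat \<beta>) (onb_mat \<gamma>))"
    unfolding C onb_contract[OF slin] by (simp add: sym3_def W_def sl_mat_simps xyz D_def)
  also have "\<dots> = 0"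
    unfolding scaleC_sum_right[symmetric] W0 by simp
  finally show ?thesis .
qed

lemma lie_jacobi_mat:
  "commutator (sl_mat x) (sl_mat (lie y z)) + commutator (sl_mat z) (sl_mat (lie x y))
   + commutator (sl_mat y) (sl_mat (lie z x)) = 0"
  by (simp add: sl_mat_simps commutator_def algebra_simps)

lemma vector_relations: "yangian_relators sl_mat (\<lambda>x. c *\<^sub>C sl_mat x) \<subseteq> {0}"
  unfolding yangian_relators_vanish_iff sym3_vector_vanish commutator_simps
  unfolding scaleC_add_right[symmetric] lie_jacobi_mat
  by (simp add: clinear_def sl_mat_simps scaleC_simps mult.commute)

text \<open>The contragredient action, in coordinates with respect to the dual basis.\<close>

definition dual_mat :: "sl3 \<Rightarrow> 3 cmatrix" where
  "dual_mat x = - mtranspose (sl_mat x)"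

lemma dual_comm: "commutator (dual_mat x) (dual_mat y) = dual_mat (lie x y)"
  by (simp add: dual_mat_def sl_mat_simps commutator_def mtranspose_simps mtranspose_mult)

lemma sym3_dual: "sym3 (dual_mat x) (dual_mat y) (dual_mat z) = - mtranspose (sym3 (sl_mat x) (sl_mat y) (sl_mat z))"
  by (simp add: dual_mat_def sym3_def mtranspose_simps mtranspose_mult mult.assoc add_ac scaleC_simps)

lemma dual_relations: "yangian_relators dual_mat (\<lambda>x. c *\<^sub>C dual_mat x) \<subseteq> {0}"
proof -
  have lin: "clinear dual_mat"
    by (simp add: clinear_def dual_mat_def sl_mat_simps mtranspose_simps scaleC_simps)
  have jac: "dual_mat (lie x (lie y z)) + dual_mat (lie z (lie x y)) + dual_mat (lie y (lie z x)) = 0" for x y z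
    by (simp add: clinear_add[OF lin, symmetric] jacobi clinear_zero[OF lin])
  have van: "(\<Sum>\<alpha><8. \<Sum>\<beta><8. \<Sum>\<gamma><8. form (lie x (onb \<alpha>)) (lie (lie y (onb \<beta>)) (lie z (onb \<gamma>))) *\<^sub>C
      sym3 (dual_mat (onb \<alpha>)) (dual_mat (onb \<beta>)) (dual_mat (onb \<gamma>))) = 0" for x y z
    using arg_cong[OF sym3_vector_vanish[of x y z], of "\<lambda>M. - mtranspose M"]
    by (simp add: sym3_dual mtranspose_sum mtranspose_simps sum_negf scaleC_minus_right)
  show ?thesis
    unfolding yangian_relators_vanish_iff van commutator_simps dual_comm
    unfolding scaleC_add_right[symmetric] jac
    using lin by (simp add: clinear_def scaleC_simps mult.commute)
qed

lift_definition vector_repr :: "complex \<Rightarrow> yangian \<Rightarrow> 3 cmatrix"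
  is "\<lambda>c. free_lift (yangian_gen_val sl_mat (\<lambda>x. c *\<^sub>C sl_mat x))"
  by (rule free_lift_respects[OF vector_relations])

lift_definition dual_repr :: "complex \<Rightarrow> yangian \<Rightarrow> 3 cmatrix"
  is "\<lambda>c. free_lift (yangian_gen_val dual_mat (\<lambda>x. c *\<^sub>C dual_mat x))"
  by (rule free_lift_respects[OF dual_relations])

definition V_lambda1 :: "complex \<Rightarrow> 3 yangian_module" where
  "V_lambda1 c = Yangian_module (vector_repr c)"

definition V_lambda2 :: "complex \<Rightarrow> 3 yangian_module" where
  "V_lambda2 c = Yangian_module (dual_repr c)"

lemma repr_V_lambda1: "repr (V_lambda1 c) = vector_repr c"
  unfolding V_lambda1_def by (rule Yangian_module_inverse) (simp add: alg_hom_yangianI[OF vector_repr.abs_eq])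

lemma repr_V_lambda2: "repr (V_lambda2 c) = dual_repr c"
  unfolding V_lambda2_def by (rule Yangian_module_inverse) (simp add: alg_hom_yangianI[OF dual_repr.abs_eq])

lemma repr_V_lambda1_gens: "repr (V_lambda1 c) (yX x) = sl_mat x" "repr (V_lambda1 c) (yJ x) = c *\<^sub>C sl_mat x"
  and repr_V_lambda2_gens: "repr (V_lambda2 c) (yX x) = dual_mat x" "repr (V_lambda2 c) (yJ x) = c *\<^sub>C dual_mat x"
  by (simp_all add: repr_V_lambda1 repr_V_lambda2 vector_repr.abs_eq dual_repr.abs_eq yX.abs_eq yJ.abs_eq yangian_gen_val_def)


section \<open>The basis \<open>T\<^sub>i\<^sup>(\<^sup>j\<^sup>)\<close> and the maximally entangled states\<close>

definition omega :: complex where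
  "omega = exp (2 * of_real pi * \<i> / 3)"

text \<open>Indices are integers, read modulo 3 through \<^term>\<open>of_int :: int \<Rightarrow> 3\<close>.\<close>

definition Eij :: "int \<Rightarrow> int \<Rightarrow> 3 cmatrix" where
  "Eij p q = Cmat (\<chi> r s. of_bool (r = of_int p \<and> s = of_int q))"

definition T_mat :: "int \<Rightarrow> int \<Rightarrow> 3 cmatrix" where
  "T_mat i j = (\<Sum>p = 1..3. omega powi ((i - 1) * (p - 1)) *\<^sub>C Eij p (p + j - 1))"

text \<open>Only meaningful for \<open>(i, j) \<noteq> (1, 1)\<close> modulo 3, when \<^term>\<open>T_mat i j\<close> is traceless.\<close>

definition T_elt :: "int \<Rightarrow> int \<Rightarrow> sl3" where
  "T_elt i j = Sl (T_mat i j)"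

definition u_vec :: "int \<Rightarrow> complex^3" where
  "u_vec p = axis (of_int (p + 1)) 1"

text \<open>The dual basis vector, in coordinates with respect to the dual basis.\<close>

definition u_dual :: "int \<Rightarrow> complex^3" where
  "u_dual q = axis (of_int (q + 1)) 1"

definition ket :: "int \<Rightarrow> int \<Rightarrow> complex^(3 \<times> 3)" where
  "ket p q = tensor_vec (u_vec p) (u_dual q)"

definition psi :: "int \<Rightarrow> int \<Rightarrow> complex^(3 \<times> 3)" where
  "psi k m = (1 / of_real (sqrt 3)) *s
     (ket 0 (m - 1) + omega powi (k - 1) *s ket 1 m + omega powi (2 * (k - 1)) *s ket 2 (m + 1))"

definition delta3 :: "int \<Rightarrow> int \<Rightarrow> complex" where
  "delta3 p q = of_bool (p mod 3 = q mod 3)"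

lemma entry_Eij: "entry (Eij p q) r s = of_bool (r = of_int p \<and> s = of_int q)"
  by (simp add: Eij_def entry.rep_eq Cmat_inverse)

lemma of_int_3_eq_iff: "(of_int p :: 3) = of_int q \<longleftrightarrow> p mod 3 = q mod 3"
proof -
  have a: "(of_int p :: 3) = of_int (p mod 3)" for p
  proof -
    have "(of_int p :: 3) = of_int (3 * (p div 3) + p mod 3)" by simp
    also have "\<dots> = 3 * of_int (p div 3) + of_int (p mod 3)" by (simp only: of_int_add of_int_mult of_int_numeral)
    also have "(3 :: 3) = 0" by simp
    finally show ?thesis by simp
  qed
  have "r = s" if "(of_int r :: 3) = of_int s" "r \<in> {0, 1, 2}" "s \<in> {0, 1, 2}" for r s :: int
    using that by auto
  moreover have "p mod 3 \<in> {0, 1, 2}" "q mod 3 \<in> {0, 1, 2}" by auto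
  ultimately show ?thesis using a[of p] a[of q] by metis
qed

lemma Eij_u: "mat_of (Eij (p + 1) (q + 1)) *v u_vec c = (if q mod 3 = c mod 3 then u_vec p else 0)"
proof -
  have "q mod 3 = c mod 3 \<longleftrightarrow> (of_int (q + 1) :: 3) = of_int (c + 1)"
    by (simp add: of_int_3_eq_iff[symmetric])
  then show ?thesis
    by (auto simp: Eij_def Cmat_inverse vec_eq_iff matrix_vector_mult_def u_vec_def axis_def
        if_distrib[of "\<lambda>t. _ * t"] cong: if_cong)
qed

lemma Eij_u_dual:
  "mat_of (- mtranspose (Eij (p + 1) (q + 1))) *v u_dual c = (if p mod 3 = c mod 3 then - u_dual q else 0)"
proof -
  have "p mod 3 = c mod 3 \<longleftrightarrow> (of_int (p + 1) :: 3) = of_int (c + 1)"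
    by (simp add: of_int_3_eq_iff[symmetric])
  then show ?thesis
    by (auto simp: Eij_def mtranspose.rep_eq uminus_cmatrix.rep_eq transpose_def Cmat_inverse vec_eq_iff
        matrix_vector_mult_def u_dual_def axis_def if_distrib[of "\<lambda>t. _ * t"] cong: if_cong)
qed

lemma omega_pow3: "omega ^ 3 = 1"
  using exp_two_pi_i by (simp add: omega_def exp_of_nat_mult[symmetric] mult_ac)

lemma omega_sum: "1 + omega + omega ^ 2 = 0"
proof -
  have "omega \<noteq> 1"
  proof
    assume "omega = 1"
    then obtain n :: int where "2 * pi / 3 = of_int (2 * n) * pi"
      by (auto simp: omega_def exp_eq_1)
    then have "1 = 3 * real_of_int n" by (simp add: field_simps)
    then have "1 = 3 * n" by linarith
    then show False by presburger
  qed
  moreover have "(1 - omega) * (1 + omega + omega ^ 2) = 0"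
    using omega_pow3 by (simp add: algebra_simps power2_eq_square power3_eq_cube)
  ultimately show ?thesis by simp
qed

lemma sum_int_3: "(\<Sum>p = 1..3::int. f p) = f 1 + f 2 + f 3"
proof -
  have "{1..3::int} = {1, 2, 3}" by auto
  then show ?thesis by (simp add: add.assoc)
qed

lemma T_traceless:
  assumes "i \<in> {1..3}" "j \<in> {1..3}" "(i, j) \<noteq> (1, 1)"
  shows "tr (T_mat i j) = 0"
proof -
  have "i = 1 \<or> i = 2 \<or> i = 3" "j = 1 \<or> j = 2 \<or> j = 3" using assms by auto
  then show ?thesis
    using assms(3) omega_sum omega_pow3
    by (auto simp: T_mat_def sum_int_3 tr_entry sum_3 entry_Eij power2_eq_square power4_eq_xxxx power3_eq_cube
        power_int_numeral algebra_simps)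
qed

lemma sl_mat_T:
  "i \<in> {1..3} \<Longrightarrow> j \<in> {1..3} \<Longrightarrow> (i, j) \<noteq> (1, 1) \<Longrightarrow> sl_mat (T_elt i j) = T_mat i j"
  using T_traceless by (simp add: T_elt_def Sl_inverse)

end

theory Submission
  imports Defs
begin

text \<open>Identify \<open>V(\<lambda>\<^sub>1) \<otimes> V(\<lambda>\<^sub>2)\<close> with the \<open>3 \<times> 3\<close> matrices, so that \<open>x \<otimes> y\<close> acts by
  \<open>M \<mapsto> - x M y\<close>. Then \<open>\<Omega>\<close> acts by \<open>M \<mapsto> M/3 - tr M\<close>, hence \<open>J(x)\<close> acts by
  \<open>M \<mapsto> a x M - b M x + (tr (x M) - tr M x)/2\<close>, and \<open>\<psi>\<close> with indices \<open>k, m\<close> corresponds to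
  \<open>T / \<surd>3\<close> with the same indices. The matrices \<open>T\<close> multiply as in a twisted group algebra of
  \<open>\<int>/3 \<times> \<int>/3\<close>, and only the unit has nonzero trace.\<close>

text \<open>Rows index the basis of the first factor, columns the dual basis of the second.\<close>

definition vec_of :: "'n::finite cmatrix \<Rightarrow> complex^('n \<times> 'n)" where
  "vec_of M = (\<chi> r. entry M (fst r) (snd r))"

lemma vec_of_simps:
  "vec_of (A + B) = vec_of A + vec_of B" "vec_of (A - B) = vec_of A - vec_of B"
  "vec_of (c *\<^sub>C A) = c *s vec_of A"
  by (simp_all add: vec_of_def vec_eq_iff)

lemma mat_of_mult_vec:
  "mat_of (A + B) *v v = mat_of A *v v + mat_of B *v v"
  "mat_of (A - B) *v v = mat_of A *v v - mat_of B *v v"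
  "mat_of (c *\<^sub>C A) *v v = c *s (mat_of A *v v)"
  "mat_of (A * B) *v v = mat_of A *v (mat_of B *v v)"
proof -
  show "mat_of (A + B) *v v = mat_of A *v v + mat_of B *v v"
    "mat_of (A - B) *v v = mat_of A *v v - mat_of B *v v"
    by (simp_all add: plus_cmatrix.rep_eq minus_cmatrix.rep_eq matrix_vector_mult_add_rdistrib
        matrix_vector_mult_diff_rdistrib)
  show "mat_of (c *\<^sub>C A) *v v = c *s (mat_of A *v v)"
    by (simp add: scaleC_cmatrix.rep_eq vec_eq_iff matrix_vector_mult_def sum_distrib_left mult.assoc)
  show "mat_of (A * B) *v v = mat_of A *v (mat_of B *v v)"
    by (simp add: times_cmatrix.rep_eq matrix_vector_mul_assoc)
qed

text \<open>\<open>B\<close> acts on the column index, hence from the right and transposed. For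
  \<open>B = dual_mat y\<close> this cancels the transpose in the contragredient action.\<close>

lemma kronecker_vec_of:
  "mat_of (kronecker A B) *v vec_of M = vec_of (A * M * mtranspose B)"
proof -
  have "(\<Sum>s\<in>UNIV. \<Sum>t\<in>UNIV. entry A p s * entry B q t * entry M s t)
      = (\<Sum>t\<in>UNIV. (\<Sum>s\<in>UNIV. entry A p s * entry M s t) * entry B q t)" for p q
    by (subst sum.swap) (simp add: sum_distrib_left mult_ac)
  moreover have "mat_of (kronecker A B) $ r $ s = entry A (fst r) (fst s) * entry B (snd r) (snd s)" for r s
    by (simp add: kronecker.rep_eq entry.rep_eq)
  ultimately show ?thesis
    by (simp add: vec_eq_iff matrix_vector_mult_def vec_of_def entry_mult UNIV_Times_UNIV[symmetric] sum.cartesian_product'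
        del: UNIV_Times_UNIV)
qed

lemma kronecker_sum_vec_of:
  "mat_of (\<Sum>i\<in>S. kronecker (A i) (B i)) *v vec_of M = vec_of (\<Sum>i\<in>S. A i * M * mtranspose (B i))"
proof (induction S rule: infinite_finite_induct)
  case (insert i S)
  then show ?case by (simp add: mat_of_mult_vec kronecker_vec_of vec_of_simps)
qed (simp_all add: zero_cmatrix.rep_eq vec_of_def vec_eq_iff)

lemma mtranspose_dual_mat: "mtranspose (dual_mat x) = - sl_mat x"
  by (rule cmatrix_eqI) (simp add: dual_mat_def)

text \<open>This is the completeness relation \<open>onb_mat_contract\<close> with trivial outer
  factors; the dual action contributes the overall sign.\<close>

lemma Omega_vec_of:
  "mat_of (tensor_repr (V_lambda1 a) (V_lambda2 b) Omega) *v vec_of M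
    = vec_of ((1/3) *\<^sub>C M - tr M *\<^sub>C 1)"
proof -
  have "(\<Sum>\<alpha><8. onb_mat \<alpha> * M * mtranspose (dual_mat (onb \<alpha>))) = (1/3) *\<^sub>C M - tr M *\<^sub>C 1"
    using arg_cong[OF onb_mat_contract[of 1 M 1], of uminus]
    by (simp only: mtranspose_dual_mat mult_minus_right sum_negf mult.assoc mult_1_left mult_1_right
        minus_diff_eq)
  then show ?thesis
    by (simp add: Omega_def alg_hom_simps[OF alg_hom_tensor_repr] tensor_repr_tens
        repr_V_lambda1_gens repr_V_lambda2_gens kronecker_sum_vec_of)
qed

text \<open>In the commutator of \<open>yX x\<close> on the first factor with \<open>Omega\<close>,
  the scalar part M/3 cancels and only the trace part survives.\<close>

lemma act_yJ_vec_of: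
  "act (V_lambda1 a \<otimes>\<^sub>Y V_lambda2 b) (yJ x) (vec_of M) =
    vec_of (a *\<^sub>C (sl_mat x * M) - b *\<^sub>C (M * sl_mat x)
      + (1/2) *\<^sub>C (tr (sl_mat x * M) *\<^sub>C 1 - tr M *\<^sub>C sl_mat x))"
proof -
  have t: "mtranspose 1 = (1 :: 3 cmatrix)"
    by (rule cmatrix_eqI) auto
  show ?thesis
    by (simp add: act_def repr_tensor_module coproduct_yJ commutator_def tensor_repr_tens
        alg_hom_simps[OF alg_hom_tensor_repr] alg_hom_simps[OF alg_hom_repr]
        repr_V_lambda1_gens repr_V_lambda2_gens mat_of_mult_vec kronecker_vec_of Omega_vec_of
        mtranspose_dual_mat mtranspose_simps t ring_distribs scaleC_simps)
      (simp add: vec_of_def vec_eq_iff algebra_simps)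
qed

lemma omega_nonzero [simp]: "omega \<noteq> 0"
  by (simp add: omega_def)

lemma omega_powi_cong:
  assumes "m mod 3 = n mod 3"
  shows "omega powi m = omega powi n"
proof -
  have "omega powi m = omega powi (m mod 3)" for m
  proof -
    have "omega powi m = omega powi (3 * (m div 3) + m mod 3)" by simp
    also have "\<dots> = (omega powi 3) powi (m div 3) * omega powi (m mod 3)"
      by (simp only: power_int_add power_int_mult omega_nonzero simp_thms)
    finally show ?thesis by (simp add: omega_pow3)
  qed
  from this[of m] this[of n] assms show ?thesis by simp
qed

text \<open>The representatives match the summation range in \<open>T_mat\<close>.\<close>

lemma of_int_3_cases:
  fixes r :: 3
  obtains p :: int where "p \<in> {1..3}" "r = of_int p"
  using exhaust_3[of r] that[of 1] that[of 2] that[of 3] by auto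

text \<open>Each row has a single nonzero entry. Allowing every integer \<open>p\<close> lets
  products use the row \<open>p + j - 1\<close> without reducing it modulo 3.\<close>

lemma entry_T_mat:
  "entry (T_mat i j) (of_int p) s = omega powi ((i - 1) * (p - 1)) * of_bool (s = of_int (p + j - 1))"
proof -
  obtain p' :: int where p': "p' \<in> {1..3}" "(of_int p :: 3) = of_int p'"
    by (rule of_int_3_cases)
  then have m: "p mod 3 = p' mod 3" by (simp add: of_int_3_eq_iff)
  have "((i - 1) * (p - 1)) mod 3 = ((i - 1) * (p' - 1)) mod 3"
    using m by (metis mod_diff_left_eq mod_mult_right_eq)
  then have w: "omega powi ((i - 1) * (p - 1)) = omega powi ((i - 1) * (p' - 1))"
    by (rule omega_powi_cong)
  have q: "p' mod 3 = q mod 3 \<longleftrightarrow> q = p'" if "q \<in> {1..3}" for q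
    using that p'(1) unfolding atLeastAtMost_iff by presburger
  have "entry (T_mat i j) (of_int p) s
      = (\<Sum>q = 1..3. if q = p' then omega powi ((i - 1) * (q - 1)) * of_bool (s = of_int (q + j - 1)) else 0)"
    unfolding T_mat_def entry_sum
    by (intro sum.cong refl) (auto simp: entry_Eij p'(2) of_int_3_eq_iff q)
  also have "\<dots> = omega powi ((i - 1) * (p' - 1)) * of_bool (s = of_int (p' + j - 1))"
    using p'(1) by simp
  finally show ?thesis
    unfolding w by (simp add: p'(2))
qed

lemma T_mat_cong:
  assumes "i mod 3 = i' mod 3" "j mod 3 = j' mod 3"
  shows "T_mat i j = T_mat i' j'"
proof (rule cmatrix_eqI)
  fix r s :: 3
  obtain p :: int where p: "r = of_int p" using of_int_3_cases by blast
  have "omega powi ((i - 1) * (p - 1)) = omega powi ((i' - 1) * (p - 1))"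
    using assms(1) by (intro omega_powi_cong) (metis mod_diff_left_eq mod_mult_left_eq)
  moreover have "(of_int j :: 3) = of_int j'"
    using assms(2) by (simp add: of_int_3_eq_iff)
  ultimately show "entry (T_mat i j) r s = entry (T_mat i' j') r s"
    unfolding p entry_T_mat by simp
qed

lemma T_mat_1_1: "T_mat 1 1 = 1"
proof (rule cmatrix_eqI)
  fix r s :: 3
  obtain p :: int where "r = of_int p" using of_int_3_cases by blast
  then show "entry (T_mat 1 1) r s = entry 1 r s" by (auto simp: entry_T_mat)
qed

text \<open>Row \<open>p\<close> of the first factor selects row \<open>p + j - 1\<close> of the
  second. The phase there exceeds the phase at row \<open>p\<close> by
  \<open>omega powi ((j - 1) * (k - 1))\<close>, which does not depend on \<open>p\<close> and so
  factors out.\<close>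

lemma T_mat_mult:
  "T_mat i j * T_mat k m = omega powi ((j - 1) * (k - 1)) *\<^sub>C T_mat (i + k - 1) (m + j - 1)"
proof (rule cmatrix_eqI)
  fix r s :: 3
  obtain p :: int where p: "r = of_int p" using of_int_3_cases by blast
  have "entry (T_mat i j * T_mat k m) r s
      = omega powi ((i - 1) * (p - 1)) * entry (T_mat k m) (of_int (p + j - 1)) s"
    by (simp add: entry_mult p entry_T_mat mult.assoc sum_distrib_left[symmetric] del: of_int_add of_int_diff)
  also have "\<dots> = omega powi ((i - 1) * (p - 1) + (k - 1) * (p + j - 1 - 1))
      * of_bool (s = of_int (p + j - 1 + m - 1))"
    by (simp only: entry_T_mat power_int_add omega_nonzero simp_thms mult.assoc)
  also have "(i - 1) * (p - 1) + (k - 1) * (p + j - 1 - 1)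
      = (j - 1) * (k - 1) + (i + k - 1 - 1) * (p - 1)"
    by (simp add: algebra_simps)
  also have "p + j - 1 + m - 1 = p + (m + j - 1) - 1"
    by simp
  finally show "entry (T_mat i j * T_mat k m) r s
      = entry (omega powi ((j - 1) * (k - 1)) *\<^sub>C T_mat (i + k - 1) (m + j - 1)) r s"
    by (simp only: p entry_simps entry_T_mat power_int_add omega_nonzero simp_thms mult.assoc)
qed

lemma tr_T_mat: "tr (T_mat k m) = 3 * delta3 k 1 * delta3 m 1"
proof (cases "k mod 3 = 1 \<and> m mod 3 = 1")
  case True
  then have "T_mat k m = 1"
    using T_mat_cong[of k 1 m 1] by (simp add: T_mat_1_1)
  with True show ?thesis by (simp add: tr_one3 delta3_def)
next
  case False
  \<comment> \<open>\<open>T_traceless\<close> expects indices in \<open>{1..3}\<close>; the shift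
    by one sends multiples of 3 to 3 instead of 0.\<close>
  define k' m' where "k' = (k - 1) mod 3 + 1" and "m' = (m - 1) mod 3 + 1"
  have k: "k' mod 3 = k mod 3" and m: "m' mod 3 = m mod 3"
    unfolding k'_def m'_def by presburger+
  have "k' \<in> {1..3}" "m' \<in> {1..3}"
    unfolding k'_def m'_def by (auto simp: zle_add1_eq_le[symmetric] add.commute)
  moreover have "(k', m') \<noteq> (1, 1)" using False k m by auto
  ultimately have "tr (T_mat k' m') = 0" by (rule T_traceless)
  moreover have "T_mat k' m' = T_mat k m" using k m by (rule T_mat_cong)
  ultimately show ?thesis using False by (auto simp: delta3_def)
qed

lemma psi_T_mat: "psi k m = vec_of ((1 / of_real (sqrt 3)) *\<^sub>C T_mat k m)"
proof -
  \<comment> \<open>Matrix units count from 1, kets from 0.\<close>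
  have ket: "ket p q = vec_of (Eij (p + 1) (q + 1))" for p q
    by (auto simp: ket_def tensor_vec_def u_vec_def u_dual_def vec_of_def entry_Eij vec_eq_iff axis_def)
  show ?thesis
    by (simp add: psi_def ket T_mat_def sum_int_3 vec_of_simps mult.commute[of 2] scaleC_one ac_simps)
qed

theorem theorem5p1:
  fixes a b :: complex and i j k m :: int
  assumes "i \<in> {1..3}" and "j \<in> {1..3}" and "(i, j) \<noteq> (1, 1)"
    and "k \<in> {1..3}" and "m \<in> {1..3}"
  shows "act (V_lambda1 a \<otimes>\<^sub>Y V_lambda2 b) (yJ (T_elt i j)) (psi k m) =
    (a * omega powi ((j - 1) * (k - 1)) - b * omega powi ((i - 1) * (m - 1))
      + 3/2 * delta3 (i + k - 1) 1 * delta3 (m + j - 1) 1 * omega powi ((j - 1) * (k - 1))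
      - 3/2 * delta3 k 1 * delta3 m 1) *s psi (i + k - 1) (m + j - 1)"
proof -
  define T where "T = T_mat (i + k - 1) (m + j - 1)"
  define w where "w = omega powi ((j - 1) * (k - 1))"
  define d where "d = delta3 (i + k - 1) 1 * delta3 (m + j - 1) 1"
  define e where "e = delta3 k 1 * delta3 m 1"
  define c :: complex where "c = 1 / of_real (sqrt 3)"
  have xM: "T_mat i j * T_mat k m = w *\<^sub>C T"
    by (simp add: T_mat_mult T_def w_def)
  \<comment> \<open>Reversing the factors gives the same \<open>T\<close>, since its indices add
    commutatively; only the phase changes.\<close>
  have Mx: "T_mat k m * T_mat i j = omega powi ((i - 1) * (m - 1)) *\<^sub>C T"
    by (simp add: T_mat_mult T_def add.commute mult.commute)
  have tr: "tr T = 3 * d" "tr (T_mat k m) = 3 * e"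
    by (simp_all add: T_def d_def e_def tr_T_mat)
  \<comment> \<open>The trace terms produce multiples of \<open>1\<close> and of
    \<open>T_mat i j\<close> rather than of \<open>T\<close>. Their coefficients carry
    \<open>d\<close> and \<open>e\<close>, which vanish unless these matrices equal
    \<open>T\<close>.\<close>
  have unit: "d *\<^sub>C 1 = d *\<^sub>C T"
  proof (cases "d = 0")
    case False
    then have "(i + k - 1) mod 3 = 1 mod 3" "(m + j - 1) mod 3 = 1 mod 3"
      unfolding d_def delta3_def by simp_all
    then have "T = T_mat 1 1"
      unfolding T_def by (rule T_mat_cong)
    then show ?thesis by (simp add: T_mat_1_1)
  qed simp
  have elt: "e *\<^sub>C T_mat i j = e *\<^sub>C T"
  proof (cases "e = 0")
    case False
    then have "k mod 3 = 1 mod 3" "m mod 3 = 1 mod 3"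
      unfolding e_def delta3_def by simp_all
    then have "(i + k - 1) mod 3 = i mod 3" "(m + j - 1) mod 3 = j mod 3"
      unfolding mod_eq_dvd_iff by (simp_all add: algebra_simps)
    then have "T = T_mat i j"
      unfolding T_def by (rule T_mat_cong)
    then show ?thesis by simp
  qed simp
  have unit': "(z * d) *\<^sub>C 1 = (z * d) *\<^sub>C T" and elt': "(z * e) *\<^sub>C T_mat i j = (z * e) *\<^sub>C T" for z
    by (simp_all add: scaleC_scaleC[symmetric] unit elt)
  \<comment> \<open>As \<open>(i, j)\<close> is not \<open>(1, 1)\<close>, \<open>T_elt i j\<close>
    really has matrix \<open>T_mat i j\<close>. The factor 3 is the trace of the identity; with the
    1/2 of the coproduct it yields the 3/2 of the claim.\<close>
  have "act (V_lambda1 a \<otimes>\<^sub>Y V_lambda2 b) (yJ (T_elt i j)) (psi k m)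
      = vec_of ((a * (c * w)) *\<^sub>C T - (b * (c * omega powi ((i - 1) * (m - 1)))) *\<^sub>C T
        + (1/2) *\<^sub>C (((c * w * 3) * d) *\<^sub>C 1 - ((c * 3) * e) *\<^sub>C T_mat i j))"
    by (simp add: psi_T_mat act_yJ_vec_of sl_mat_T[OF assms(1-3)] xM Mx tr c_def[symmetric]
        scaleC_simps mult.assoc)
  also have "\<dots> = (a * w - b * omega powi ((i - 1) * (m - 1)) + 3/2 * d * w - 3/2 * e) *s vec_of (c *\<^sub>C T)"
    unfolding unit' elt' by (simp add: vec_of_def vec_eq_iff algebra_simps)
  finally show ?thesis
    by (simp add: psi_T_mat T_def w_def d_def e_def c_def mult.assoc)
qed

end
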